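(* Let $m,n\ge1$ and $k\ge2$ be integers, let $1<p_i<\infty$ for $i=1,\dots,m$, and let $p$ be defined by $\frac1p=\sum_{i=1}^m\frac1{p_i}$. Let $p<q<\infty$ and $0<\alpha_1,\dots,\alpha_k<mn$. Let $u$ be an a.e. positive function on $\mathbb{R}^{kn}$ such that $u^q$ is a weight. Then there is a constant $c>0$ such that the inequality $$\| u\, \mathcal{M}_{\alpha_1, \dots, \alpha_k}^{(S)}(\overrightarrow{f})\|_{L^q(\mathbb{R}^{kn})} \leq c\prod_{i=1}^{m} \|f_i \|_{L^{p_i}(\mathbb{R}^{kn})}$$ holds for all $\overrightarrow{f}=(f_1,\dots,f_m) \in L^{p_1}(\mathbb{R}^{kn}) \times \cdots \times L^{p_m}(\mathbb{R}^{kn})$ if and only if $$\sup_{Q_1,\dots, Q_k\in\mathcal{Q}} \bigg( \int_{Q_1\times \cdots \times Q_k}u^q (x)\, dx \bigg) |Q_1|^{q(\alpha_1/n-1/p)} \cdots |Q_k|^{q(\alpha_k/n-1/p)} < \infty.$$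
   Context: $\mathcal{Q}$ is the family of all cubes in $\mathbb{R}^n$ with sides parallel to the coordinate axes, and $|Q|$ is the volume of $Q$. A weight is an a.e. positive, locally integrable function. Points of $\mathbb{R}^{kn}$ are written $x=(x^{(1)},\dots,x^{(k)})$ with $x^{(j)}\in\mathbb{R}^n$. The multi(sub)linear strong fractional maximal operator is $$\mathcal{M}^{(S)}_{\alpha_1,\dots, \alpha_k}(\overrightarrow{f})(x) = \sup_{ Q^{(1)} \times \cdots \times Q^{(k)} \ni x}\ \frac{1}{ |Q^{(1)}|^{m-\alpha_1/n} \cdots |Q^{(k)}|^{m-\alpha_k/n} } \prod_{i=1}^m \int_{Q^{(1)}\times\cdots \times Q^{(k)}} |f_i(y_i)|\,dy_i,$$ where the supremum is taken over all products of cubes $Q^{(1)},\dots,Q^{(k)}\in\mathcal{Q}$ containing $x^{(1)},\dots,x^{(k)}$ respectively. *)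

theory Defs
  imports "HOL-Analysis.Analysis"
begin

text \<open>
  Points of the space of dimension \<open>k n\<close> are \<open>x :: real^'n^'k\<close>, where \<open>n = CARD('n)\<close> and
  \<open>k = CARD('k)\<close>; the block \<open>x\<^sup>(\<^sup>j\<^sup>)\<close> is \<open>x $ j\<close>. Tuples of functions are indexed by a finite type
  \<open>'m\<close> with \<open>m = CARD('m)\<close>. Measurability is Lebesgue measurability throughout.
\<close>

text \<open>The cubes are closed and nondegenerate.\<close>

definition cubes :: "(real^'n) set set" where
  "cubes = {cbox a (a + (\<chi> i. s)) | a s. 0 < s}"

definition block_prod :: "('k \<Rightarrow> (real^'n) set) \<Rightarrow> (real^'n^'k) set" where
  "block_prod Q = {x. \<forall>j. x $ j \<in> Q j}"

definition is_weight :: "('a::euclidean_space \<Rightarrow> real) \<Rightarrow> bool" where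
  "is_weight w \<longleftrightarrow>
     (AE x in lebesgue. 0 < w x) \<and> (\<forall>K. compact K \<longrightarrow> w absolutely_integrable_on K)"

text \<open>Real powers on \<open>[0, \<infinity>]\<close>, meant for positive exponents only.\<close>

definition ennpowr :: "ennreal \<Rightarrow> real \<Rightarrow> ennreal" where
  "ennpowr t r = (if t = \<infinity> then \<infinity> else ennreal (enn2real t powr r))"

text \<open>
  The (quasi-)norm of \<open>L\<^sup>p\<close> for \<open>0 < p < \<infinity>\<close>, applied to the absolute value of a function; the
  values are in \<open>[0, \<infinity>]\<close> because a maximal function may be infinite.
\<close>

definition lp_norm :: "real \<Rightarrow> ('a::euclidean_space \<Rightarrow> ennreal) \<Rightarrow> ennreal" where
  "lp_norm p g = ennpowr (\<integral>\<^sup>+x. ennpowr (g x) p \<partial>lebesgue) (1 / p)"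

definition lp_space :: "real \<Rightarrow> ('a::euclidean_space \<Rightarrow> real) set" where
  "lp_space p = {f \<in> borel_measurable lebesgue. lp_norm p (\<lambda>x. ennreal \<bar>f x\<bar>) < \<infinity>}"

definition strong_frac_max ::
    "('k::finite \<Rightarrow> real) \<Rightarrow> ('m::finite \<Rightarrow> real^'n^'k \<Rightarrow> real) \<Rightarrow> real^'n^'k \<Rightarrow> ennreal" where
  "strong_frac_max \<alpha> f x =
     (SUP Q \<in> {Q. (\<forall>j. Q j \<in> cubes) \<and> x \<in> block_prod Q}.
        ennreal (1 / (\<Prod>j\<in>UNIV. measure lebesgue (Q j) powr (CARD('m) - \<alpha> j / CARD('n)))) *
        (\<Prod>i\<in>UNIV. \<integral>\<^sup>+y\<in>block_prod Q. ennreal \<bar>f i y\<bar> \<partial>lebesgue))"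

end

theory Submission
  imports Defs
begin

text \<open>
  Necessity follows by testing the inequality on indicators of products of cubes. For sufficiency, the maximal
  function is dominated by the sum over all products \<open>R\<close> of dyadic boxes. The hypothesis bounds the
  \<open>u\<^sup>q\<close>-measure of \<open>R\<close> by a power of its side volumes, and Hoelder's inequality over \<open>R\<close> with the weights
  \<open>p / p\<^sub>i\<close> leaves one linear estimate for each function, the Carleson embedding
  \<open>\<Sum>\<^sub>R (|R|\<^bsup>1/p-1\<^esup> \<integral>\<^sub>R f)\<^sup>q \<le> C \<parallel>f\<parallel>\<^sub>p\<^sup>q\<close> for \<open>1 < p < q\<close>. In a single block it is elementary. As its kernel is
  positive and \<open>p < q\<close>, Minkowski's inequality allows to treat the blocks one at a time.
\<close>

subsection \<open>Powers on the extended half-line\<close>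

text \<open>The sum over all boxes is affordable because the embedding gains at both ends of the
  range of scales. For the indicator of the unit cube, the boxes of volume \<open>V\<close>
  contribute about \<open>V powr (q / p - 1)\<close> when \<open>V\<close> is small and
  \<open>V powr (q * (1 / p - 1))\<close> when \<open>V\<close> is large: geometric series, the
  former by \<open>p < q\<close>, the latter by \<open>1 < p\<close>. The embedding is therefore
  applied to \<open>f i\<close> with the exponents \<open>ps i > 1\<close> and
  \<open>qs i = q * ps i / p > ps i\<close>, and never with the given \<open>p\<close>, which may be
  below 1. The \<open>\<alpha> j\<close> leave no trace in it: the \<open>q\<close>-th power of the
  fractional volume factor times the bound for the weight has, in each side volume, the exponent
  \<open>q * (1 / p - CARD('m))\<close>, which is the sum over \<open>i\<close> of
  \<open>q * (1 / ps i - 1)\<close>, one share per function. The side lengths of the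
  \<open>k\<close> factors vary independently, so products of boxes are not ordered by size;
  factoring the kernel over the blocks avoids any geometry of such products.\<close>

lemma ennpowr_ennreal: "0 \<le> x \<Longrightarrow> ennpowr (ennreal x) r = ennreal (x powr r)"
  by (simp add: ennpowr_def)

lemma ennpowr_top [simp]: "ennpowr top r = top"
  by (simp add: ennpowr_def)

lemma ennpowr_0 [simp]: "ennpowr 0 r = 0"
  by (simp add: ennpowr_def)

lemma ennpowr_1 [simp]: "ennpowr 1 r = 1"
  by (simp add: ennpowr_def)

lemma ennpowr_one [simp]: "ennpowr t 1 = t"
  by (cases t) (auto simp: ennpowr_def)

lemma ennpowr_eq_0_iff [simp]: "ennpowr t r = 0 \<longleftrightarrow> t = 0"
  by (cases t) (auto simp: ennpowr_def)

lemma ennpowr_eq_top_iff [simp]: "ennpowr t r = top \<longleftrightarrow> t = top"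
  by (cases t) (auto simp: ennpowr_def)

text \<open>No condition on \<open>r\<close>: the points \<open>0\<close> and \<open>top\<close> are
  fixed by every power, zero and negative exponents included, and \<open>0 * top = 0\<close> on both
  sides. The same convention makes the laws for iterated powers and for sums of exponents
  unconditional.\<close>

lemma ennpowr_mult: "ennpowr (a * b) r = ennpowr a r * ennpowr b r"
proof (cases "a = top \<or> b = top")
  case True
  then show ?thesis
    by (cases "a = 0 \<or> b = 0") (auto simp: ennreal_mult_top ennreal_top_mult)
next
  case False
  then obtain x y where "a = ennreal x" "b = ennreal y" "0 \<le> x" "0 \<le> y"
    by (cases a; cases b) auto
  then show ?thesis
    by (simp add: ennpowr_ennreal powr_mult flip: ennreal_mult)
qed

lemma ennpowr_ennpowr: "ennpowr (ennpowr a r) s = ennpowr a (r * s)"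
  by (cases a) (auto simp: ennpowr_ennreal powr_powr)

lemma ennpowr_add: "ennpowr a (r + s) = ennpowr a r * ennpowr a s"
  by (cases a) (auto simp: ennpowr_ennreal powr_add ennreal_mult ennreal_top_mult)

lemma ennpowr_mono:
  assumes "0 \<le> r" "a \<le> b"
  shows "ennpowr a r \<le> ennpowr b r"
proof (cases "b = top")
  case False
  with assms obtain x y where "a = ennreal x" "b = ennreal y" "0 \<le> x" "0 \<le> y"
    by (cases a; cases b) (auto simp: top_unique)
  with assms show ?thesis
    by (auto simp: ennpowr_ennreal intro!: ennreal_leI powr_mono2)
qed auto

lemma ennpowr_inverse: "0 < r \<Longrightarrow> ennpowr (ennpowr a r) (1 / r) = a"
  by (simp add: ennpowr_ennpowr)

lemma ennpowr_inverse': "0 < r \<Longrightarrow> ennpowr (ennpowr a (1 / r)) r = a"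
  by (simp add: ennpowr_ennpowr)

lemma ennpowr_le_iff:
  assumes "0 < r"
  shows "ennpowr a r \<le> b \<longleftrightarrow> a \<le> ennpowr b (1 / r)"
  using ennpowr_mono[of "1 / r" "ennpowr a r" b] ennpowr_mono[of r a "ennpowr b (1 / r)"] assms
  by (auto simp: ennpowr_inverse ennpowr_inverse')

text \<open>A power with positive exponent is an order isomorphism of the half-line, with inverse
  exponent \<open>1 / r\<close>, so it preserves suprema.\<close>

lemma ennpowr_SUP:
  assumes "0 < r"
  shows "ennpowr (SUP i\<in>I. f i) r = (SUP i\<in>I. ennpowr (f i) r)"
proof (rule antisym)
  show "ennpowr (SUP i\<in>I. f i) r \<le> (SUP i\<in>I. ennpowr (f i) r)"
    unfolding ennpowr_le_iff[OF assms]
    by (intro SUP_least, subst ennpowr_le_iff[OF assms, symmetric], rule SUP_upper)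
qed (use assms in \<open>auto intro!: SUP_least ennpowr_mono SUP_upper\<close>)

lemma ennpowr_prod: "ennpowr (\<Prod>i\<in>I. f i) r = (\<Prod>i\<in>I. ennpowr (f i) r)"
  by (induction I rule: infinite_finite_induct) (auto simp: ennpowr_mult)

lemma measurable_ennpowr [measurable]:
  assumes [measurable]: "f \<in> borel_measurable M"
  shows "(\<lambda>x. ennpowr (f x) r) \<in> borel_measurable M"
  unfolding ennpowr_def by measurable

lemma ennpowr_add_le:
  assumes "0 \<le> r"
  shows "ennpowr (a + b) r \<le> ennreal (2 powr r) * (ennpowr a r + ennpowr b r)"
proof -
  have "a + b \<le> 2 * max a b"
    by (metis add_mono max.cobounded1 max.cobounded2 mult_2)
  then have "ennpowr (a + b) r \<le> ennpowr (2 * max a b) r"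
    by (rule ennpowr_mono[OF assms])
  also have "\<dots> = ennreal (2 powr r) * ennpowr (max a b) r"
    using ennpowr_ennreal[of 2 r] by (simp add: ennpowr_mult)
  also have "\<dots> \<le> ennreal (2 powr r) * (ennpowr a r + ennpowr b r)"
    by (intro mult_left_mono) (auto simp: max_def)
  finally show ?thesis .
qed

subsection \<open>The inequalities of Hoelder and Minkowski\<close>

text \<open>Convexity of the exponential at the points \<open>ln (x i)\<close>. A vanishing
  \<open>x i\<close> has no logarithm, but it makes the left side zero.\<close>

lemma weighted_arith_geo_mean:
  fixes \<theta> x :: "'i \<Rightarrow> real"
  assumes "finite I" "\<And>i. i \<in> I \<Longrightarrow> 0 \<le> \<theta> i" "sum \<theta> I = 1" "\<And>i. i \<in> I \<Longrightarrow> 0 \<le> x i"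
  shows "(\<Prod>i\<in>I. x i powr \<theta> i) \<le> (\<Sum>i\<in>I. \<theta> i * x i)"
proof (cases "\<exists>i\<in>I. x i = 0")
  case True
  then have "(\<Prod>i\<in>I. x i powr \<theta> i) = 0"
    using assms(1) by auto
  also have "0 \<le> (\<Sum>i\<in>I. \<theta> i * x i)"
    using assms by (intro sum_nonneg) auto
  finally show ?thesis .
next
  case False
  then have pos: "\<And>i. i \<in> I \<Longrightarrow> 0 < x i"
    using assms(4) by force
  have "I \<noteq> {}"
    using assms(3) by auto
  have "(\<Prod>i\<in>I. x i powr \<theta> i) = exp (\<Sum>i\<in>I. \<theta> i *\<^sub>R ln (x i))"
    using pos by (auto simp: exp_sum[OF assms(1)] powr_def less_imp_neq[symmetric] intro!: prod.cong)
  also have "\<dots> \<le> (\<Sum>i\<in>I. \<theta> i * exp (ln (x i)))"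
    using assms \<open>I \<noteq> {}\<close> by (intro convex_on_sum[OF _ _ exp_convex]) auto
  also have "\<dots> = (\<Sum>i\<in>I. \<theta> i * x i)"
    using pos by (intro sum.cong) auto
  finally show ?thesis .
qed

text \<open>The weights are strictly positive because an infinite \<open>x i\<close> has to make the
  right side infinite, while \<open>0 * top = 0\<close>.\<close>

lemma ennreal_weighted_arith_geo_mean:
  assumes "finite I" "\<And>i. i \<in> I \<Longrightarrow> 0 < \<theta> i" "sum \<theta> I = 1"
  shows "(\<Prod>i\<in>I. ennpowr (x i) (\<theta> i)) \<le> (\<Sum>i\<in>I. ennreal (\<theta> i) * x i)"
proof (cases "\<exists>i\<in>I. x i = top")
  case True
  then have "(\<Sum>i\<in>I. ennreal (\<theta> i) * x i) = top"
    using assms by (auto simp: ennreal_mult_eq_top_iff) (metis ennreal_eq_0_iff not_le)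
  then show ?thesis
    by simp
next
  case False
  define y where "y i = enn2real (x i)" for i
  have x: "x i = ennreal (y i)" and y: "0 \<le> y i" if "i \<in> I" for i
    using that False by (auto simp: y_def less_top)
  have "(\<Prod>i\<in>I. ennpowr (x i) (\<theta> i)) = ennreal (\<Prod>i\<in>I. y i powr \<theta> i)"
    using x y by (simp add: ennpowr_ennreal flip: prod_ennreal)
  also have "\<dots> \<le> ennreal (\<Sum>i\<in>I. \<theta> i * y i)"
    using assms y by (intro ennreal_leI weighted_arith_geo_mean) (auto simp: less_imp_le)
  also have "\<dots> = (\<Sum>i\<in>I. ennreal (\<theta> i) * x i)"
    using x y assms(2) by (auto simp: less_imp_le ennreal_mult simp flip: sum_ennreal intro!: sum.cong)
  finally show ?thesis .
qed

text \<open>Dividing each \<open>g i\<close> by its integral reduces the claim to integrating the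
  weighted mean inequality pointwise. Vanishing integrals are treated before infinite ones, since a
  single zero makes the right side zero even next to an infinite factor.\<close>

lemma nn_integral_Hoelder:
  assumes "finite I" "\<And>i. i \<in> I \<Longrightarrow> 0 < \<theta> i" "sum \<theta> I = 1"
    and [measurable]: "\<And>i. i \<in> I \<Longrightarrow> g i \<in> borel_measurable M"
  shows "(\<integral>\<^sup>+x. (\<Prod>i\<in>I. ennpowr (g i x) (\<theta> i)) \<partial>M) \<le> (\<Prod>i\<in>I. ennpowr (\<integral>\<^sup>+x. g i x \<partial>M) (\<theta> i))"
proof -
  define c where "c i = (\<integral>\<^sup>+x. g i x \<partial>M)" for i
  consider (zero) i where "i \<in> I" "c i = 0" | (top) i where "i \<in> I" "c i = top" "\<forall>i\<in>I. c i \<noteq> 0"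
    | (pos) "\<And>i. i \<in> I \<Longrightarrow> c i \<noteq> 0" "\<And>i. i \<in> I \<Longrightarrow> c i \<noteq> top"
    by auto
  then show ?thesis
  proof cases
    case zero
    then have "AE x in M. g i x = 0"
      by (simp add: c_def nn_integral_0_iff_AE)
    then have "AE x in M. (\<Prod>i\<in>I. ennpowr (g i x) (\<theta> i)) = 0"
      by eventually_elim (use zero(1) assms(1) in auto)
    then have "(\<integral>\<^sup>+x. (\<Prod>i\<in>I. ennpowr (g i x) (\<theta> i)) \<partial>M) = 0"
      by (subst nn_integral_0_iff_AE) auto
    then show ?thesis
      by simp
  next
    case top
    then have "(\<Prod>i\<in>I. ennpowr (c i) (\<theta> i)) = top"
      using assms(1) by (auto simp: ennreal_prod_eq_top)
    then show ?thesis
      by (simp add: c_def)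
  next
    case pos
    have g: "g i x = c i * (g i x / c i)" if "i \<in> I" for i x
      using pos[OF that] by (simp add: ennreal_times_divide mult.commute[of "c i"] ennreal_mult_divide_eq)
    have "(\<integral>\<^sup>+x. (\<Prod>i\<in>I. ennpowr (g i x) (\<theta> i)) \<partial>M)
        = (\<integral>\<^sup>+x. (\<Prod>i\<in>I. ennpowr (c i) (\<theta> i)) * (\<Prod>i\<in>I. ennpowr (g i x / c i) (\<theta> i)) \<partial>M)"
      by (simp add: prod.distrib[symmetric] ennpowr_mult[symmetric] g[symmetric] cong: prod.cong)
    also have "\<dots> = (\<Prod>i\<in>I. ennpowr (c i) (\<theta> i)) * (\<integral>\<^sup>+x. (\<Prod>i\<in>I. ennpowr (g i x / c i) (\<theta> i)) \<partial>M)"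
      by (rule nn_integral_cmult) simp
    also have "\<dots> \<le> (\<Prod>i\<in>I. ennpowr (c i) (\<theta> i)) * (\<integral>\<^sup>+x. (\<Sum>i\<in>I. ennreal (\<theta> i) * (g i x / c i)) \<partial>M)"
      by (intro mult_left_mono nn_integral_mono ennreal_weighted_arith_geo_mean assms) auto
    also have "(\<integral>\<^sup>+x. (\<Sum>i\<in>I. ennreal (\<theta> i) * (g i x / c i)) \<partial>M) = (\<Sum>i\<in>I. ennreal (\<theta> i) * (c i / c i))"
      by (subst nn_integral_sum) (auto simp: nn_integral_cmult nn_integral_divide c_def intro!: sum.cong)
    also have "\<dots> = (\<Sum>i\<in>I. ennreal (\<theta> i))"
      using pos by (intro sum.cong) (auto simp: ennreal_divide_self less_top)
    also have "\<dots> = 1"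
      using assms(2,3) by (simp add: less_imp_le sum_ennreal)
    finally show ?thesis
      by (simp add: c_def)
  qed
qed

lemma nn_integral_Hoelder2:
  assumes "0 < \<theta>" "\<theta> < 1" and [measurable]: "f \<in> borel_measurable M" "g \<in> borel_measurable M"
  shows "(\<integral>\<^sup>+x. ennpowr (f x) \<theta> * ennpowr (g x) (1 - \<theta>) \<partial>M)
    \<le> ennpowr (\<integral>\<^sup>+x. f x \<partial>M) \<theta> * ennpowr (\<integral>\<^sup>+x. g x \<partial>M) (1 - \<theta>)"
  using nn_integral_Hoelder[of UNIV "\<lambda>b. if b then \<theta> else 1 - \<theta>" "\<lambda>b. if b then f else g" M] assms
  by (simp add: UNIV_bool mult.commute)

text \<open>The classical argument: split one factor \<open>G\<close> off
  \<open>ennpowr G r\<close>, exchange the integrals, apply Hoelder in \<open>s\<close>, and cancel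
  a power of the integral of \<open>ennpowr G r\<close>. Cancelling needs a finite integral, so it
  is done for truncations of \<open>G\<close> that increase to \<open>G\<close>.\<close>

lemma (in pair_sigma_finite) nn_integral_Minkowski:
  assumes "1 \<le> r" and [measurable]: "case_prod F \<in> borel_measurable (M1 \<Otimes>\<^sub>M M2)"
  shows "ennpowr (\<integral>\<^sup>+s. ennpowr (\<integral>\<^sup>+x. F s x \<partial>M2) r \<partial>M1) (1 / r)
    \<le> (\<integral>\<^sup>+x. ennpowr (\<integral>\<^sup>+s. ennpowr (F s x) r \<partial>M1) (1 / r) \<partial>M2)"
proof (cases "r = 1")
  case True
  then show ?thesis
    using Fubini'[of F] by simp
next
  case False
  define \<theta> where "\<theta> = 1 / r"
  have r: "1 < r" "0 < \<theta>" "\<theta> < 1" "r * \<theta> = 1" "r * (1 - \<theta>) = r - 1" "\<theta> * r = 1"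
    using False \<open>1 \<le> r\<close> by (auto simp: \<theta>_def right_diff_distrib)
  define R where "R = (\<integral>\<^sup>+x. ennpowr (\<integral>\<^sup>+s. ennpowr (F s x) r \<partial>M1) \<theta> \<partial>M2)"
  define G where "G s = (\<integral>\<^sup>+x. F s x \<partial>M2)" for s
  have [measurable]: "G \<in> borel_measurable M1"
    unfolding G_def by measurable
  obtain A :: "nat \<Rightarrow> 'a set" where A: "range A \<subseteq> sets M1" "(\<Union>i. A i) = space M1"
      "\<And>i. emeasure M1 (A i) \<noteq> \<infinity>" "incseq A"
    using M1.sigma_finite_incseq by blast
  have [measurable]: "A n \<in> sets M1" for n
    using A(1) by auto
  \<comment> \<open>Cut in height by \<open>n\<close> and in support to a set of finite measure:
    both are needed to make the integral of the \<open>r\<close>-th power finite.\<close>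
  define H where "H n s = min (G s) (of_nat n) * indicator (A n) s" for n s
  have [measurable]: "H n \<in> borel_measurable M1" for n
    unfolding H_def by measurable
  have H_le: "H n s \<le> G s" "H n s \<le> of_nat n * indicator (A n) s" for n s
    by (auto simp: H_def split: split_indicator)
  have "incseq (\<lambda>n. H n s)" for s
    using incseqD[OF A(4)]
    by (auto simp: H_def incseq_def min.coboundedI2 le_infI2 split: split_indicator)
  have H_SUP: "(SUP n. H n s) = G s" if s: "s \<in> space M1" for s
  proof (rule antisym)
    show "G s \<le> (SUP n. H n s)"
      unfolding le_SUP_iff
    proof safe
      fix y assume y: "y < G s"
      then obtain n where n: "y < of_nat n"
        using ennreal_Ex_less_of_nat[of y] less_top_ennreal by (metis order_less_le_trans top_greatest)
      obtain m where m: "s \<in> A m"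
        using s A(2) by auto
      have "s \<in> A (max m n)"
        using m A(4) by (meson incseqD in_mono max.cobounded1)
      moreover have "(of_nat n :: ennreal) \<le> of_nat (max m n)"
        by (intro of_nat_mono) auto
      ultimately have "y < H (max m n) s"
        using y n by (simp add: H_def order_less_le_trans)
      then show "\<exists>i\<in>UNIV. y < H i s"
        by blast
    qed
  qed (auto intro!: SUP_least H_le)
  have *: "(\<integral>\<^sup>+s. ennpowr (H n s) r \<partial>M1) \<le> ennpowr R r" for n
  proof -
    define I where "I = (\<integral>\<^sup>+s. ennpowr (H n s) r \<partial>M1)"
    have "I \<le> (\<integral>\<^sup>+s. ennpowr (of_nat n) r * indicator (A n) s \<partial>M1)"
      unfolding I_def using H_le(2)[of n] ennpowr_mono[of r] r(1)
      by (intro nn_integral_mono) (auto split: split_indicator simp: H_def)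
    also have "\<dots> < \<infinity>"
      using A(3)[of n] by (auto simp: ennreal_mult_less_top ennreal_mult_eq_top_iff less_top[symmetric] nn_integral_cmult_indicator)
    finally have fin: "I \<noteq> \<infinity>"
      by simp
    \<comment> \<open>Only one factor is enlarged to \<open>G\<close>; the remaining power
      \<open>r - 1\<close> stays truncated, so that Hoelder gives back the finite quantity
      \<open>I\<close>.\<close>
    have "I \<le> (\<integral>\<^sup>+s. ennpowr (H n s) (r - 1) * G s \<partial>M1)"
      unfolding I_def
    proof (intro nn_integral_mono)
      fix s
      have "ennpowr (H n s) r = ennpowr (H n s) (r - 1) * H n s"
        using ennpowr_add[of "H n s" "r - 1" 1] by simp
      also have "\<dots> \<le> ennpowr (H n s) (r - 1) * G s"
        by (intro mult_left_mono H_le) auto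
      finally show "ennpowr (H n s) r \<le> ennpowr (H n s) (r - 1) * G s" .
    qed
    also have "\<dots> = (\<integral>\<^sup>+s. \<integral>\<^sup>+x. ennpowr (H n s) (r - 1) * F s x \<partial>M2 \<partial>M1)"
      unfolding G_def by (intro nn_integral_cong nn_integral_cmult[symmetric]) measurable
    also have "\<dots> = (\<integral>\<^sup>+x. \<integral>\<^sup>+s. ennpowr (H n s) (r - 1) * F s x \<partial>M1 \<partial>M2)"
      by (rule Fubini'[symmetric]) measurable
    also have "\<dots> \<le> (\<integral>\<^sup>+x. ennpowr (\<integral>\<^sup>+s. ennpowr (F s x) r \<partial>M1) \<theta> * ennpowr I (1 - \<theta>) \<partial>M2)"
    proof (rule nn_integral_mono)
      fix x assume [measurable]: "x \<in> space M2"
      have "(\<integral>\<^sup>+s. ennpowr (H n s) (r - 1) * F s x \<partial>M1)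
        = (\<integral>\<^sup>+s. ennpowr (ennpowr (F s x) r) \<theta> * ennpowr (ennpowr (H n s) r) (1 - \<theta>) \<partial>M1)"
        by (simp add: ennpowr_ennpowr r mult.commute)
      also have "\<dots> \<le> ennpowr (\<integral>\<^sup>+s. ennpowr (F s x) r \<partial>M1) \<theta> * ennpowr I (1 - \<theta>)"
        unfolding I_def by (rule nn_integral_Hoelder2) (use r in auto)
      finally show "(\<integral>\<^sup>+s. ennpowr (H n s) (r - 1) * F s x \<partial>M1) \<le> \<dots>" .
    qed
    also have "\<dots> = ennpowr I (1 - \<theta>) * R"
      unfolding R_def by (subst nn_integral_multc) (auto simp: mult.commute)
    finally have "ennpowr I (1 - \<theta>) * ennpowr I \<theta> \<le> ennpowr I (1 - \<theta>) * R"
      by (simp flip: ennpowr_add)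
    \<comment> \<open>The common factor is cancelled when \<open>I\<close> is nonzero and finite;
      for \<open>I = 0\<close> there is nothing to show.\<close>
    then have "ennpowr I (1 / r) \<le> R"
      using fin by (cases "I = 0") (auto simp: ennreal_mult_le_mult_iff \<theta>_def)
    then show ?thesis
      using ennpowr_le_iff[of "1 / r" I R] r(1) by (simp add: I_def)
  qed
  have "(\<integral>\<^sup>+s. ennpowr (G s) r \<partial>M1) = (\<integral>\<^sup>+s. (SUP n. ennpowr (H n s) r) \<partial>M1)"
    using r(1) by (intro nn_integral_cong) (simp add: ennpowr_SUP[symmetric] H_SUP)
  also have "\<dots> = (SUP n. \<integral>\<^sup>+s. ennpowr (H n s) r \<partial>M1)"
    using \<open>\<And>s. incseq (\<lambda>n. H n s)\<close> r(1)
    by (intro nn_integral_monotone_convergence_SUP) (auto simp: incseq_def le_fun_def intro!: ennpowr_mono)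
  also have "\<dots> \<le> ennpowr R r"
    using * by (intro SUP_least)
  finally have "(\<integral>\<^sup>+s. ennpowr (G s) r \<partial>M1) \<le> ennpowr R r" .
  then show ?thesis
    using ennpowr_le_iff[of "1 / r" "\<integral>\<^sup>+s. ennpowr (G s) r \<partial>M1" R] r(1) by (simp add: R_def G_def \<theta>_def)
qed

subsection \<open>Product kernels and product measures\<close>

text \<open>Induction on the number of coordinates. Integrating \<open>f\<close> against
  \<open>K s\<close> in the new coordinate gives \<open>g s\<close>, a function of the old
  coordinates, to which the induction hypothesis applies for each fixed \<open>s\<close>. What
  remains is a mixed norm of \<open>g\<close>, whose integrals Minkowski exchanges, so that the
  bound for one coordinate can be used on slices of \<open>f\<close>.\<close>

lemma nn_integral_product_kernel_le:
  assumes "sigma_finite_measure S" "sigma_finite_measure X" "0 < p" "p \<le> q"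
    and K [measurable]: "case_prod K \<in> borel_measurable (S \<Otimes>\<^sub>M X)"
    and bound: "\<And>f. f \<in> borel_measurable X \<Longrightarrow>
      (\<integral>\<^sup>+s. ennpowr (\<integral>\<^sup>+x. K s x * f x \<partial>X) q \<partial>S) \<le> C * ennpowr (\<integral>\<^sup>+x. ennpowr (f x) p \<partial>X) (q / p)"
    and "finite I" "f \<in> borel_measurable (PiM I (\<lambda>_. X))"
  shows "(\<integral>\<^sup>+\<sigma>. ennpowr (\<integral>\<^sup>+x. (\<Prod>j\<in>I. K (\<sigma> j) (x j)) * f x \<partial>PiM I (\<lambda>_. X)) q \<partial>PiM I (\<lambda>_. S))
    \<le> C ^ card I * ennpowr (\<integral>\<^sup>+x. ennpowr (f x) p \<partial>PiM I (\<lambda>_. X)) (q / p)"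
  using assms(7,8)
proof (induction arbitrary: f)
  case empty
  interpret X: product_sigma_finite "\<lambda>_. X" by (rule product_sigma_finite.intro) fact
  interpret S: product_sigma_finite "\<lambda>_. S" by (rule product_sigma_finite.intro) fact
  show ?case
    using \<open>0 < p\<close> by (simp add: X.nn_integral_empty space_PiM_empty ennpowr_ennpowr)
next
  case (insert i I)
  interpret X: product_sigma_finite "\<lambda>_. X" by (rule product_sigma_finite.intro) fact
  interpret S: product_sigma_finite "\<lambda>_. S" by (rule product_sigma_finite.intro) fact
  interpret SX: pair_sigma_finite S "PiM I (\<lambda>_. X)"
    by (intro pair_sigma_finite.intro X.sigma_finite insert assms)
  interpret XI: sigma_finite_measure "PiM (insert i I) (\<lambda>_. X)"
    by (intro X.sigma_finite) (use insert in auto)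
  interpret X1: sigma_finite_measure X by fact
  note [measurable] = \<open>f \<in> borel_measurable (PiM (insert i I) (\<lambda>_. X))\<close>
  define g where "g s x = (\<integral>\<^sup>+y. K s y * f (x(i := y)) \<partial>X)" for s x
  have g [measurable]: "case_prod g \<in> borel_measurable (S \<Otimes>\<^sub>M PiM I (\<lambda>_. X))"
    unfolding g_def by measurable
  define r where "r = q / p"
  have r: "1 \<le> r" "0 < r" "p * r = q"
    using assms(3,4) by (auto simp: r_def)
  have split: "(\<integral>\<^sup>+x. (\<Prod>j\<in>insert i I. K ((\<sigma>(i := s)) j) (x j)) * f x \<partial>PiM (insert i I) (\<lambda>_. X))
      = (\<integral>\<^sup>+x. (\<Prod>j\<in>I. K (\<sigma> j) (x j)) * g s x \<partial>PiM I (\<lambda>_. X))"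
    if [measurable]: "\<sigma> \<in> space (PiM I (\<lambda>_. S))" "s \<in> space S" for \<sigma> s
  proof -
    have [measurable]: "\<sigma> j \<in> space S" if "j \<in> I" for j
      using \<open>\<sigma> \<in> space (PiM I (\<lambda>_. S))\<close> that by (auto simp: space_PiM)
    have [measurable]: "(\<sigma>(i := s)) j \<in> space S" if "j \<in> insert i I" for j
      using \<open>\<sigma> \<in> space (PiM I (\<lambda>_. S))\<close> \<open>s \<in> space S\<close> that by (auto simp: space_PiM)
    have "(\<integral>\<^sup>+x. (\<Prod>j\<in>insert i I. K ((\<sigma>(i := s)) j) (x j)) * f x \<partial>PiM (insert i I) (\<lambda>_. X))
        = (\<integral>\<^sup>+x. \<integral>\<^sup>+y. (\<Prod>j\<in>insert i I. K ((\<sigma>(i := s)) j) ((x(i := y)) j)) * f (x(i := y)) \<partial>X \<partial>PiM I (\<lambda>_. X))"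
      by (rule X.product_nn_integral_insert) (use insert(1,2) in measurable)
    also have "\<dots> = (\<integral>\<^sup>+x. \<integral>\<^sup>+y. (\<Prod>j\<in>I. K (\<sigma> j) (x j)) * (K s y * f (x(i := y))) \<partial>X \<partial>PiM I (\<lambda>_. X))"
      using insert(1,2)
      by (intro nn_integral_cong) (auto simp: mult_ac intro!: prod.cong arg_cong2[where f="(*)"])
    also have "\<dots> = (\<integral>\<^sup>+x. (\<Prod>j\<in>I. K (\<sigma> j) (x j)) * g s x \<partial>PiM I (\<lambda>_. X))"
      unfolding g_def using insert(1,2) by (intro nn_integral_cong nn_integral_cmult) measurable
    finally show ?thesis .
  qed
  have "(\<integral>\<^sup>+\<sigma>. ennpowr (\<integral>\<^sup>+x. (\<Prod>j\<in>insert i I. K (\<sigma> j) (x j)) * f x \<partial>PiM (insert i I) (\<lambda>_. X)) q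
        \<partial>PiM (insert i I) (\<lambda>_. S))
      = (\<integral>\<^sup>+s. \<integral>\<^sup>+\<sigma>. ennpowr (\<integral>\<^sup>+x. (\<Prod>j\<in>insert i I. K ((\<sigma>(i := s)) j) (x j)) * f x
          \<partial>PiM (insert i I) (\<lambda>_. X)) q \<partial>PiM I (\<lambda>_. S) \<partial>S)"
    by (rule S.product_nn_integral_insert_rev) (use insert(1,2) in \<open>measurable\<close>)
  also have "\<dots> = (\<integral>\<^sup>+s. \<integral>\<^sup>+\<sigma>. ennpowr (\<integral>\<^sup>+x. (\<Prod>j\<in>I. K (\<sigma> j) (x j)) * g s x \<partial>PiM I (\<lambda>_. X)) q
      \<partial>PiM I (\<lambda>_. S) \<partial>S)"
    by (intro nn_integral_cong arg_cong2[where f=ennpowr] split refl)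
  also have "\<dots> \<le> (\<integral>\<^sup>+s. C ^ card I * ennpowr (\<integral>\<^sup>+x. ennpowr (g s x) p \<partial>PiM I (\<lambda>_. X)) r \<partial>S)"
    unfolding r_def by (intro nn_integral_mono insert.IH) measurable
  also have "\<dots> = C ^ card I * (\<integral>\<^sup>+s. ennpowr (\<integral>\<^sup>+x. ennpowr (g s x) p \<partial>PiM I (\<lambda>_. X)) r \<partial>S)"
    by (rule nn_integral_cmult) measurable
  \<comment> \<open>Minkowski with exponent \<open>r = q / p \<ge> 1\<close> moves the integral over
    \<open>s\<close> inside the one over the old coordinates; this is where \<open>p \<le> q\<close>
    enters.\<close>
  also have "(\<integral>\<^sup>+s. ennpowr (\<integral>\<^sup>+x. ennpowr (g s x) p \<partial>PiM I (\<lambda>_. X)) r \<partial>S)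
      \<le> ennpowr (\<integral>\<^sup>+x. ennpowr (\<integral>\<^sup>+s. ennpowr (ennpowr (g s x) p) r \<partial>S) (1 / r) \<partial>PiM I (\<lambda>_. X)) r"
    using SX.nn_integral_Minkowski[of r "\<lambda>s x. ennpowr (g s x) p"] r by (simp add: ennpowr_le_iff)
  \<comment> \<open>With the old coordinates \<open>x\<close> frozen, \<open>p * r = q\<close> makes
    the inner integral exactly the left side of \<open>bound\<close> for the slice of
    \<open>f\<close> through \<open>x\<close>.\<close>
  also have "\<dots> \<le> ennpowr (\<integral>\<^sup>+x. ennpowr (C * ennpowr (\<integral>\<^sup>+y. ennpowr (f (x(i := y))) p \<partial>X) r) (1 / r) \<partial>PiM I (\<lambda>_. X)) r"
  proof (intro ennpowr_mono nn_integral_mono)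
    fix x assume [measurable]: "x \<in> space (PiM I (\<lambda>_. X))"
    show "(\<integral>\<^sup>+s. ennpowr (ennpowr (g s x) p) r \<partial>S) \<le> C * ennpowr (\<integral>\<^sup>+y. ennpowr (f (x(i := y))) p \<partial>X) r"
      using bound[of "\<lambda>y. f (x(i := y))"] insert(2) by (simp add: ennpowr_ennpowr r g_def flip: r_def)
  qed (use r in auto)
  also have "\<dots> = ennpowr (\<integral>\<^sup>+x. ennpowr C (1 / r) * (\<integral>\<^sup>+y. ennpowr (f (x(i := y))) p \<partial>X) \<partial>PiM I (\<lambda>_. X)) r"
    using r by (simp add: ennpowr_mult ennpowr_inverse)
  also have "\<dots> = C * ennpowr (\<integral>\<^sup>+x. \<integral>\<^sup>+y. ennpowr (f (x(i := y))) p \<partial>X \<partial>PiM I (\<lambda>_. X)) r"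
    using r insert(2) by (subst nn_integral_cmult) (auto simp: ennpowr_mult ennpowr_inverse')
  also have "(\<integral>\<^sup>+x. \<integral>\<^sup>+y. ennpowr (f (x(i := y))) p \<partial>X \<partial>PiM I (\<lambda>_. X))
      = (\<integral>\<^sup>+x. ennpowr (f x) p \<partial>PiM (insert i I) (\<lambda>_. X))"
    using insert(1,2) by (intro X.product_nn_integral_insert[symmetric]) measurable
  finally show ?case
    using insert(1,2) by (simp add: r_def mult.assoc mult.left_commute mult_left_mono)
qed

section \<open>Lebesgue measure on vectors of blocks as a product measure\<close>

lemma measurable_vec_lambda [measurable]:
  "(\<lambda>x. \<chi> j. x j) \<in> PiM UNIV (\<lambda>_::'k::finite. lborel :: 'a::euclidean_space measure) \<rightarrow>\<^sub>M borel"
proof (subst borel_measurable_euclidean_space, intro ballI)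
  fix b :: "'a^'k" assume "b \<in> Basis"
  then obtain j u where "b = axis j u" "u \<in> Basis"
    by (auto simp: Basis_vec_def)
  moreover have "(\<lambda>x. x j \<bullet> u) \<in> borel_measurable (PiM UNIV (\<lambda>_::'k. lborel :: 'a measure))"
    by measurable
  ultimately show "(\<lambda>x. (\<chi> j. x j) \<bullet> b) \<in> borel_measurable (PiM UNIV (\<lambda>_::'k. lborel :: 'a measure))"
    by (simp add: inner_axis)
qed

text \<open>Lebesgue measure is determined by its values on boxes, and the basis vectors
  \<open>axis j b\<close> group the side lengths of a box by blocks. This carries the abstract
  product kernel bound over to \<open>real^'n^'k\<close>.\<close>

lemma lborel_vec:
  "(lborel :: ('a::euclidean_space ^ 'k::finite) measure)
    = distr (PiM UNIV (\<lambda>_::'k. lborel)) borel (\<lambda>x. \<chi> j. x j)"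
proof (rule lborel_eqI)
  interpret product_sigma_finite "\<lambda>_::'k. lborel :: 'a measure"
    by unfold_locales
  fix l u :: "'a^'k" assume lu: "\<And>b. b \<in> Basis \<Longrightarrow> l \<bullet> b \<le> u \<bullet> b"
  have comp: "l $ j \<bullet> b \<le> u $ j \<bullet> b" if "b \<in> Basis" for b j
    using lu[of "axis j b"] that by (auto simp: inner_axis Basis_vec_def)
  have inj: "inj_on (\<lambda>(j, b). axis j b) (UNIV \<times> (Basis :: 'a set))" 
    by (auto simp: inj_on_def axis_eq_axis)
  have Basis: "(Basis :: ('a^'k) set) = (\<lambda>(j, b). axis j b) ` (UNIV \<times> Basis)"
    by (auto simp: Basis_vec_def)
  have "emeasure (distr (PiM UNIV (\<lambda>_::'k. lborel)) borel (\<lambda>x. \<chi> j. x j)) (box l u)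
      = emeasure (PiM UNIV (\<lambda>_::'k. lborel)) (PiE UNIV (\<lambda>j. box (l $ j) (u $ j)))"
    by (subst emeasure_distr)
       (auto simp: space_PiM PiE_iff mem_box Basis_vec_def inner_axis intro!: arg_cong2[where f=emeasure])
  also have "\<dots> = (\<Prod>j\<in>UNIV. emeasure lborel (box (l $ j) (u $ j)))"
    by (rule emeasure_PiM) auto
  also have "\<dots> = ennreal (\<Prod>j\<in>UNIV. \<Prod>b\<in>Basis. (u $ j - l $ j) \<bullet> b)"
    using comp by (simp add: prod_ennreal prod_nonneg inner_diff_left)
  also have "(\<Prod>j\<in>UNIV. \<Prod>b\<in>Basis. (u $ j - l $ j) \<bullet> b) = (\<Prod>b\<in>Basis. (u - l) \<bullet> b)"
    unfolding Basis by (subst prod.reindex[OF inj]) (auto simp: prod.cartesian_product inner_axis intro!: prod.cong)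
  finally show "emeasure (distr (PiM UNIV (\<lambda>_::'k. lborel)) borel (\<lambda>x. \<chi> j. x j)) (box l u) = (\<Prod>b\<in>Basis. (u - l) \<bullet> b)" .
qed simp

lemma nn_integral_lborel_vec:
  fixes f :: "'a::euclidean_space ^ 'k::finite \<Rightarrow> ennreal"
  assumes "f \<in> borel_measurable borel"
  shows "(\<integral>\<^sup>+x. f x \<partial>lborel) = (\<integral>\<^sup>+x. f (\<chi> j. x j) \<partial>PiM UNIV (\<lambda>_. lborel))"
  using assms by (subst lborel_vec) (auto simp: nn_integral_distr)

lemma block_prod_borel [measurable]:
  fixes Q :: "'k::finite \<Rightarrow> (real^'n) set"
  assumes "\<And>j. Q j \<in> sets borel"
  shows "block_prod Q \<in> sets borel"
proof -
  have [measurable]: "(\<lambda>x. x $ j) \<in> borel_measurable (borel :: (real^'n^'k) measure)" for j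
    by (intro borel_measurable_continuous_onI continuous_intros)
  have "block_prod Q = (\<Inter>j. (\<lambda>x. x $ j) -` Q j \<inter> space borel)"
    by (auto simp: block_prod_def)
  then show ?thesis
    using assms by (auto intro!: sets.finite_INT measurable_sets[of _ borel borel, simplified])
qed

lemma emeasure_lebesgue_block_prod:
  fixes Q :: "'k::finite \<Rightarrow> (real^'n) set"
  assumes "\<And>j. Q j \<in> sets borel"
  shows "emeasure lebesgue (block_prod Q) = (\<Prod>j\<in>UNIV. emeasure lebesgue (Q j))"
proof -
  interpret product_sigma_finite "\<lambda>_::'k. lborel :: (real^'n) measure"
    by unfold_locales
  have meas: "block_prod Q \<in> sets borel"
    using assms by (rule block_prod_borel)
  have "emeasure lborel (block_prod Q) = emeasure (PiM UNIV (\<lambda>_::'k. lborel)) (PiE UNIV Q)"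
    using meas by (subst lborel_vec, subst emeasure_distr)
       (auto simp: space_PiM block_prod_def intro!: arg_cong2[where f=emeasure])
  also have "\<dots> = (\<Prod>j\<in>UNIV. emeasure lborel (Q j))"
    using assms by (intro emeasure_PiM) auto
  finally show ?thesis
    using assms meas by simp
qed

subsection \<open>The Carleson embedding for dyadic boxes\<close>

text \<open>
  The boxes of side \<open>2\<^sup>l\<close> have their corners on the grid of mesh \<open>2\<^bsup>l-1\<^esup>\<close>. This overlap makes every cube
  lie in a box of comparable size, so that no shifted dyadic grids are needed.
\<close>

definition dyadic_box :: "int \<times> ('n::finite \<Rightarrow> int) \<Rightarrow> (real^'n) set" where
  "dyadic_box s = (let a = (\<chi> i. 2 powr (of_int (fst s) - 1) * of_int (snd s i)) in cbox a (a + (\<chi> i. 2 powr of_int (fst s))))"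

section \<open>Dyadic boxes: volume, covering of cubes, overlap\<close>

lemma measure_cube:
  fixes a :: "real^'n"
  assumes "0 \<le> s"
  shows "measure lebesgue (cbox a (a + (\<chi> i. s))) = s ^ CARD('n)"
    and "emeasure lebesgue (cbox a (a + (\<chi> i. s))) = ennreal (s ^ CARD('n))"
proof -
  show "measure lebesgue (cbox a (a + (\<chi> i. s))) = s ^ CARD('n)"
    using assms by (simp add: content_cbox_cart interval_ne_empty_cart)
  then show "emeasure lebesgue (cbox a (a + (\<chi> i. s))) = ennreal (s ^ CARD('n))"
    by (subst emeasure_eq_ennreal_measure) (auto simp: emeasure_lborel_cbox_finite[unfolded infinity_ennreal_def, THEN less_imp_neq])
qed

lemma dyadic_box_cubes: "dyadic_box s \<in> cubes"
  by (auto simp: dyadic_box_def cubes_def Let_def intro!: exI[of _ "2 powr real_of_int (fst s)"])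

lemma dyadic_box_borel [measurable]: "dyadic_box s \<in> sets borel"
  by (simp add: dyadic_box_def Let_def)

lemma measure_dyadic_box:
  "measure lebesgue (dyadic_box s :: (real^'n) set) = 2 powr (real CARD('n) * fst s)"
  "emeasure lborel (dyadic_box s :: (real^'n) set) = ennreal (2 powr (real CARD('n) * fst s))"
  using measure_cube[of "2 powr of_int (fst s)" "(\<chi> i. 2 powr (of_int (fst s) - 1) * of_int (snd s i)) :: real^'n"]
  by (simp_all add: dyadic_box_def Let_def powr_powr[symmetric] powr_realpow mult.commute[of "real CARD('n)"] del: powr_powr)

lemma cube_subset_dyadic_box:
  fixes Q :: "(real^'n) set"
  assumes "Q \<in> cubes"
  obtains s where "Q \<subseteq> dyadic_box s" "measure lebesgue (dyadic_box s) \<le> 4 ^ CARD('n) * measure lebesgue Q"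
proof -
  obtain a r where Q: "Q = cbox a (a + (\<chi> i. r))" and "0 < r"
    using assms by (auto simp: cubes_def)
  \<comment> \<open>The extra 1 makes the mesh \<open>h\<close>, which is half the side of the box,
    at least \<open>r\<close>. Rounding the corner of \<open>Q\<close> down to the grid costs at
    most one \<open>h\<close> and the cube itself at most another, so a box of side
    \<open>2 * h\<close> holds it.\<close>
  define l where "l = \<lceil>log 2 r\<rceil> + 1"
  define h :: real where "h = 2 powr (real_of_int l - 1)"
  have l2: "2 powr real_of_int l = 2 * h"
    by (simp add: h_def powr_diff)
  have h: "0 < h" "r \<le> h"
  proof -
    have "r = 2 powr (log 2 r)" using \<open>0 < r\<close> by simp
    also have "\<dots> \<le> h" unfolding h_def l_def by (intro powr_mono) auto
    finally show "r \<le> h" .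
  qed (simp add: h_def)
  have "2 * h = 2 powr real_of_int l"
    by (simp add: l2)
  \<comment> \<open>Rounding up loses at most 1 in the exponent and the extra level another 1: hence
    the side ratio 4 and the constant \<open>4 ^ CARD('n)\<close>.\<close>
  also have "\<dots> \<le> 2 powr (log 2 r + 2)"
    unfolding l_def by (intro powr_mono) linarith+
  also have "\<dots> = 4 * r"
    using \<open>0 < r\<close> by (simp add: powr_add)
  finally have h4: "2 * h \<le> 4 * r" .
  define s where "s = (l, \<lambda>i. \<lfloor>a $ i / h\<rfloor>)"
  have lo: "h * of_int \<lfloor>a $ i / h\<rfloor> \<le> a $ i" and hi: "a $ i \<le> h * of_int \<lfloor>a $ i / h\<rfloor> + h" for i
  proof -
    show "h * of_int \<lfloor>a $ i / h\<rfloor> \<le> a $ i"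
      using floor_divide_lower[OF h(1), of "a $ i"] by (simp add: mult.commute)
    show "a $ i \<le> h * of_int \<lfloor>a $ i / h\<rfloor> + h"
      using floor_divide_upper[OF h(1), of "a $ i"] by (simp add: algebra_simps)
  qed
  show ?thesis
  proof
    show "Q \<subseteq> dyadic_box s"
    proof
      fix x assume "x \<in> Q"
      then have "a $ i \<le> x $ i" "x $ i \<le> a $ i + r" for i
        by (auto simp: Q mem_box_cart)
      then have "h * of_int \<lfloor>a $ i / h\<rfloor> \<le> x $ i" "x $ i \<le> h * of_int \<lfloor>a $ i / h\<rfloor> + 2 * h" for i
        using lo[of i] hi[of i] h(2) by (smt (verit))+
      then show "x \<in> dyadic_box s"
        by (simp add: dyadic_box_def Let_def s_def mem_box_cart l2 flip: h_def)
    qed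
    have "measure lebesgue (dyadic_box s :: (real^'n) set) = (2 * h) ^ CARD('n)"
      unfolding measure_dyadic_box using l2[symmetric]
      by (simp add: s_def powr_realpow[symmetric] powr_powr mult.commute)
    also have "\<dots> \<le> (4 * r) ^ CARD('n)"
      using h h4 by (intro power_mono) auto
    also have "\<dots> = 4 ^ CARD('n) * measure lebesgue Q"
      using \<open>0 < r\<close> measure_cube(1)[of r a] by (simp add: Q power_mult_distrib)
    finally show "measure lebesgue (dyadic_box s) \<le> 4 ^ CARD('n) * measure lebesgue Q" .
  qed
qed

text \<open>Along each axis the box occupies a closed interval of two mesh widths starting at
  \<open>h * z i\<close>. This confines \<open>z i\<close> to three consecutive integers; the third
  is attained because both endpoints belong to the box.\<close>

lemma dyadic_box_overlap:
  fixes y :: "real^'n"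
  shows "(\<integral>\<^sup>+z. indicator (dyadic_box (l, z)) y \<partial>count_space UNIV) \<le> 3 ^ CARD('n)"
proof -
  define h :: real where "h = 2 powr (real_of_int l - 1)"
  have h: "0 < h" and l2: "2 powr real_of_int l = 2 * h"
    by (simp_all add: h_def powr_diff)
  define Z where "Z = PiE (UNIV :: 'n set) (\<lambda>i. {\<lfloor>y $ i / h\<rfloor> - 2 .. \<lfloor>y $ i / h\<rfloor>})"
  have Z: "z \<in> Z" if "y \<in> dyadic_box (l, z)" for z
  proof -
    have "h * z i \<le> y $ i" "y $ i \<le> h * z i + 2 * h" for i
      using that by (auto simp: dyadic_box_def Let_def mem_box_cart l2 simp flip: h_def)
    then have "z i \<le> y $ i / h" "y $ i / h \<le> z i + 2" for i
      using h by (simp_all add: field_simps)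
    then have "z i \<le> \<lfloor>y $ i / h\<rfloor>" "\<lfloor>y $ i / h\<rfloor> \<le> z i + 2" for i
      by (simp_all add: le_floor_iff floor_le_iff) (smt (verit))
    then show ?thesis
      by (simp add: Z_def PiE_iff) (smt (verit))
  qed
  have "finite Z" "card Z = 3 ^ CARD('n)"
    by (auto simp: Z_def card_PiE intro!: finite_PiE)
  have "(\<integral>\<^sup>+z. indicator (dyadic_box (l, z)) y \<partial>count_space UNIV)
      \<le> (\<integral>\<^sup>+z. indicator Z z \<partial>count_space (UNIV :: ('n \<Rightarrow> int) set))"
    using Z by (intro nn_integral_mono) (auto split: split_indicator)
  also have "\<dots> = 3 ^ CARD('n)"
    using \<open>finite Z\<close> \<open>card Z = _\<close> by simp
  finally show ?thesis .
qed

lemma nn_integral_dyadic_box_sum_le: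
  fixes g :: "real^'n \<Rightarrow> ennreal"
  assumes [measurable]: "g \<in> borel_measurable borel"
  shows "(\<integral>\<^sup>+z. \<integral>\<^sup>+y. indicator (dyadic_box (l, z)) y * g y \<partial>lborel \<partial>count_space UNIV)
    \<le> 3 ^ CARD('n) * (\<integral>\<^sup>+y. g y \<partial>lborel)"
proof -
  have "(\<integral>\<^sup>+z. \<integral>\<^sup>+y. indicator (dyadic_box (l, z)) y * g y \<partial>lborel \<partial>count_space UNIV)
      = (\<integral>\<^sup>+y. \<integral>\<^sup>+z. indicator (dyadic_box (l, z)) y * g y \<partial>count_space UNIV \<partial>lborel)"
    by (rule nn_integral_count_space_nn_integral[symmetric]) auto
  also have "\<dots> = (\<integral>\<^sup>+y. (\<integral>\<^sup>+z. indicator (dyadic_box (l, z)) y \<partial>count_space UNIV) * g y \<partial>lborel)"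
    by (intro nn_integral_cong nn_integral_multc) auto
  also have "\<dots> \<le> (\<integral>\<^sup>+y. 3 ^ CARD('n) * g y \<partial>lborel)"
    by (intro nn_integral_mono mult_right_mono dyadic_box_overlap) auto
  also have "\<dots> = 3 ^ CARD('n) * (\<integral>\<^sup>+y. g y \<partial>lborel)"
    by (rule nn_integral_cmult) auto
  finally show ?thesis .
qed

section \<open>Geometric sums over half-lines of integer scales\<close>

lemma geometric_sum_int_le:
  assumes "0 < c"
  shows "(\<integral>\<^sup>+l. ennreal (2 powr (c * real_of_int l)) * indicator {l. real_of_int l \<le> \<tau>} l \<partial>count_space UNIV)
    \<le> ennreal (2 powr (c * \<tau>) / (1 - 2 powr (- c)))"
proof -
  \<comment> \<open>Counting downwards from the largest admissible integer gives a geometric series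
    of ratio \<open>2 powr (- c)\<close> whose leading term is at most
    \<open>2 powr (c * \<tau>)\<close>.\<close>
  define L where "L = \<lfloor>\<tau>\<rfloor>"
  have *: "{l. real_of_int l \<le> \<tau>} = {..L}"
    by (auto simp: L_def le_floor_iff)
  have bij: "bij_betw (\<lambda>k. L - int k) UNIV {..L}"
    by (rule bij_betwI[of _ _ _ "\<lambda>l. nat (L - l)"]) auto
  have lt1: "norm (2 powr (- c)) < (1::real)"
    using assms by (simp add: powr_less_one)
  have expand: "2 powr (c * real_of_int (L - int k)) = 2 powr (c * real_of_int L) * (2 powr (- c)) ^ k" for k
    by (simp add: powr_realpow[symmetric] powr_powr powr_add[symmetric] right_diff_distrib)
  have sums: "(\<lambda>k. 2 powr (c * real_of_int L) * (2 powr (- c)) ^ k) sums (2 powr (c * real_of_int L) * (1 / (1 - 2 powr (- c))))"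
    by (intro sums_mult geometric_sums lt1)
  have "(\<integral>\<^sup>+l. ennreal (2 powr (c * real_of_int l)) * indicator {l. real_of_int l \<le> \<tau>} l \<partial>count_space UNIV)
      = (\<integral>\<^sup>+l. ennreal (2 powr (c * real_of_int l)) \<partial>count_space {..L})"
    by (simp add: * nn_integral_count_space_indicator)
  also have "\<dots> = (\<integral>\<^sup>+k. ennreal (2 powr (c * real_of_int (L - int k))) \<partial>count_space UNIV)"
    by (rule nn_integral_bij_count_space[OF bij, symmetric])
  also have "\<dots> = (\<Sum>k. ennreal (2 powr (c * real_of_int L) * (2 powr (- c)) ^ k))"
    unfolding nn_integral_count_space_nat expand ..
  also have "\<dots> = ennreal (2 powr (c * real_of_int L) * (1 / (1 - 2 powr (- c))))"
    by (intro suminf_ennreal_eq sums) auto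
  also have "\<dots> \<le> ennreal (2 powr (c * \<tau>) / (1 - 2 powr (- c)))"
    using lt1 assms by (auto intro!: ennreal_leI divide_right_mono powr_mono simp: L_def)
  finally show ?thesis .
qed

lemma geometric_sum_int_ge:
  assumes "0 < c"
  shows "(\<integral>\<^sup>+l. ennreal (2 powr (- c * real_of_int l)) * indicator {l. \<tau> < real_of_int l} l \<partial>count_space UNIV)
    \<le> ennreal (2 powr (- c * \<tau>) / (1 - 2 powr (- c)))"
proof -
  have bij: "bij_betw uminus (UNIV :: int set) UNIV"
    by (rule bij_betwI[of _ _ _ uminus]) auto
  have "(\<integral>\<^sup>+l. ennreal (2 powr (- c * real_of_int l)) * indicator {l. \<tau> < real_of_int l} l \<partial>count_space UNIV)
      = (\<integral>\<^sup>+l. ennreal (2 powr (- c * real_of_int (- l))) * indicator {l. \<tau> < real_of_int l} (- l) \<partial>count_space UNIV)"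
    by (rule nn_integral_bij_count_space[OF bij, symmetric])
  also have "\<dots> \<le> (\<integral>\<^sup>+l. ennreal (2 powr (c * real_of_int l)) * indicator {l. real_of_int l \<le> - \<tau>} l \<partial>count_space UNIV)"
    by (intro nn_integral_mono) (auto split: split_indicator)
  also have "\<dots> \<le> ennreal (2 powr (- c * \<tau>) / (1 - 2 powr (- c)))"
    using geometric_sum_int_le[OF assms, of "- \<tau>"] by simp
  finally show ?thesis .
qed

text \<open>Hoelder against the constant 1 on \<open>B\<close>, with weights \<open>1 / q\<close>
  and \<open>1 - 1 / q\<close>.\<close>

lemma nn_integral_Jensen_powr:
  assumes "1 < q" and [measurable]: "f \<in> borel_measurable M" "B \<in> sets M"
  shows "ennpowr (\<integral>\<^sup>+x. indicator B x * f x \<partial>M) q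
    \<le> ennpowr (emeasure M B) (q - 1) * (\<integral>\<^sup>+x. indicator B x * ennpowr (f x) q \<partial>M)"
proof -
  have q: "0 < 1 / q" "1 / q < 1" "(1 - 1 / q) * q = q - 1" "0 < q"
    using assms(1) by (auto simp: field_simps)
  have "(\<integral>\<^sup>+x. indicator B x * f x \<partial>M)
      = (\<integral>\<^sup>+x. ennpowr (indicator B x * ennpowr (f x) q) (1 / q) * ennpowr (indicator B x) (1 - 1 / q) \<partial>M)"
    using q(4) by (intro nn_integral_cong) (auto split: split_indicator simp: ennpowr_inverse)
  also have "\<dots> \<le> ennpowr (\<integral>\<^sup>+x. indicator B x * ennpowr (f x) q \<partial>M) (1 / q) * ennpowr (emeasure M B) (1 - 1 / q)"
    using nn_integral_Hoelder2[OF q(1,2), of "\<lambda>x. indicator B x * ennpowr (f x) q" M "indicator B"] by simp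
  finally show ?thesis
    using ennpowr_mono[of q] q by (fastforce simp: ennpowr_mult ennpowr_inverse' ennpowr_ennpowr mult.commute)
qed

text \<open>The exponent is the scale-invariant one: by Hoelder, integrating \<open>f\<close>
  against the kernel of any single box gives at most the \<open>p\<close>-norm of \<open>f\<close>,
  whatever the size of the box.\<close>

definition dyadic_kernel :: "real \<Rightarrow> int \<times> ('n::finite \<Rightarrow> int) \<Rightarrow> real^'n \<Rightarrow> ennreal" where
  "dyadic_kernel p s y = ennreal (measure lebesgue (dyadic_box s) powr (1 / p - 1)) * indicator (dyadic_box s) y"

lemma measurable_dyadic_kernel [measurable]:
  "case_prod (dyadic_kernel p) \<in> borel_measurable (count_space UNIV \<Otimes>\<^sub>M lborel)"
  by (rule measurable_pair_measure_countable1) (auto simp: dyadic_kernel_def)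

text \<open>Turns a cut in height into a threshold for the scale: at a fixed point, the scales at
  which the value counts as high form an upper half-line and the others a lower one, which is the
  form the geometric sums need.\<close>

lemma powr_less_iff_level:
  fixes d p x y :: real
  assumes "1 < p" "0 < d" "0 < x"
  shows "2 powr (- d * y / p) < x \<longleftrightarrow> - p * log 2 x / d < y"
proof -
  have "2 powr (- d * y / p) < x \<longleftrightarrow> - d * y / p < log 2 x"
    using assms by (simp add: less_log_iff)
  also have "\<dots> \<longleftrightarrow> - d * y < p * log 2 x"
    using assms pos_divide_less_eq[of p "- d * y" "log 2 x"] by (simp add: mult.commute)
  also have "\<dots> \<longleftrightarrow> - p * log 2 x / d < y"
    using assms pos_divide_less_eq[of d "- p * log 2 x" y]
    by (simp add: mult.commute minus_less_iff)
  finally show ?thesis .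
qed

text \<open>Here \<open>t\<close> is the value of the function at one point and
  \<open>V = 2 powr (d * l)\<close> the volume at scale \<open>l\<close>. The value is high where
  \<open>V > t powr (- p)\<close>. There the factors \<open>V powr (1 / p - 1)\<close> decay
  geometrically, by \<open>1 < p\<close>, and at the threshold the factor is
  \<open>t powr (p - 1)\<close>, so the sum is of order \<open>t powr p\<close>.\<close>

lemma weighted_sum_high_levels:
  fixes d p :: real
  assumes "1 < p" "0 < d"
  shows "(\<integral>\<^sup>+l. ennreal (2 powr (d * of_int l * (1 / p - 1))) *
      (if ennreal (2 powr (- d * of_int l / p)) < t then t else 0) \<partial>count_space UNIV)
    \<le> ennreal (1 / (1 - 2 powr (- d * (1 - 1 / p)))) * ennpowr t p"
proof -
  consider "t = 0" | "t = top" | x where "t = ennreal x" "0 < x"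
    by (cases t) (metis ennreal_0 order_le_less)+
  then show ?thesis
  proof cases
    case 1
    then show ?thesis by simp
  next
    case 2
    \<comment> \<open>An infinite value needs an infinite right side, so the constant must be seen
      to be nonzero.\<close>
    have "0 < 1 / (1 - 2 powr (- d * (1 - 1 / p)))"
      using assms by (auto simp: field_simps intro!: powr_less_one)
    then have "ennreal (1 / (1 - 2 powr (- d * (1 - 1 / p)))) \<noteq> 0"
      by (metis ennreal_eq_0_iff not_le)
    then show ?thesis
      using 2 by (simp add: ennreal_mult_top del: ennreal_eq_0_iff)
  next
    case 3
    define c where "c = d * (1 - 1 / p)"
    define \<tau> where "\<tau> = - p * log 2 x / d"
    have "0 < c"
      using assms by (simp add: c_def)
    have iff: "ennreal (2 powr (- d * of_int l / p)) < t \<longleftrightarrow> \<tau> < of_int l" for l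
      using 3 assms unfolding \<tau>_def
      by (subst powr_less_iff_level[symmetric]) (auto simp: ennreal_less_iff)
    have c: "d * of_int l * (1 / p - 1) = - c * of_int l" for l :: int
      by (simp add: c_def algebra_simps)
    have "- c * \<tau> = log 2 x * (p - 1)"
      using assms by (simp add: c_def \<tau>_def field_simps)
    then have "2 powr (- c * \<tau>) = 2 powr (log 2 x * (p - 1))"
      by simp
    also have "\<dots> = x powr (p - 1)"
      using 3 by (simp add: powr_powr[symmetric])
    finally have \<tau>: "2 powr (- c * \<tau>) = x powr (p - 1)" .
    have "(\<integral>\<^sup>+l. ennreal (2 powr (d * of_int l * (1 / p - 1))) *
        (if ennreal (2 powr (- d * of_int l / p)) < t then t else 0) \<partial>count_space UNIV)
        = (\<integral>\<^sup>+l. ennreal (2 powr (- c * of_int l)) * indicator {l. \<tau> < real_of_int l} l * t \<partial>count_space UNIV)"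
      unfolding iff c by (intro nn_integral_cong) (auto simp: indicator_def)
    also have "\<dots> \<le> ennreal (x powr (p - 1) / (1 - 2 powr (- c))) * t"
      using geometric_sum_int_ge[OF \<open>0 < c\<close>, of \<tau>, unfolded \<tau>]
      by (subst nn_integral_multc) (auto intro!: mult_right_mono)
    also have "\<dots> = ennreal (1 / (1 - 2 powr (- c)) * x powr p)"
    proof -
      have "x powr (p - 1) * x = x powr p"
        using 3 by (simp add: powr_diff)
      then show ?thesis
        using 3 by (simp add: ennreal_mult''[symmetric])
    qed
    also have "\<dots> = ennreal (1 / (1 - 2 powr (- d * (1 - 1 / p)))) * ennpowr t p"
      by (simp only: 3(1) ennpowr_ennreal[OF less_imp_le[OF 3(2)]] ennreal_mult''[OF powr_ge_zero]
          c_def minus_mult_left)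
    finally show ?thesis .
  qed
qed

text \<open>The counterpart for \<open>V \<le> t powr (- p)\<close>. The factors
  \<open>V powr (q / p - 1)\<close> grow with the scale, by \<open>p < q\<close>, up to
  \<open>t powr (p - q)\<close> at the threshold; multiplied by \<open>t powr q\<close> this is
  again \<open>t powr p\<close>.\<close>

lemma weighted_sum_low_levels:
  fixes d p q :: real
  assumes "1 < p" "p < q" "0 < d"
  shows "(\<integral>\<^sup>+l. ennreal (2 powr (d * of_int l * (q / p - 1))) *
      ennpowr (if ennreal (2 powr (- d * of_int l / p)) < t then 0 else t) q \<partial>count_space UNIV)
    \<le> ennreal (1 / (1 - 2 powr (- d * (q / p - 1)))) * ennpowr t p"
proof -
  consider "t = 0" | "t = top" | x where "t = ennreal x" "0 < x"
    by (cases t) (metis ennreal_0 order_le_less)+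
  then show ?thesis
  proof cases
    case 3
    define c where "c = d * (q / p - 1)"
    define \<tau> where "\<tau> = - p * log 2 x / d"
    have "0 < c"
      using assms by (simp add: c_def)
    have iff: "ennreal (2 powr (- d * of_int l / p)) < t \<longleftrightarrow> \<tau> < of_int l" for l
      using 3 assms unfolding \<tau>_def
      by (subst powr_less_iff_level[symmetric]) (auto simp: ennreal_less_iff)
    have c: "d * of_int l * (q / p - 1) = c * of_int l" for l :: int
      by (simp add: c_def algebra_simps)
    have "c * \<tau> = log 2 x * (p - q)"
      using assms by (simp add: c_def \<tau>_def field_simps)
    then have "2 powr (c * \<tau>) = 2 powr (log 2 x * (p - q))"
      by simp
    also have "\<dots> = x powr (p - q)"
      using 3 by (simp add: powr_powr[symmetric])
    finally have \<tau>: "2 powr (c * \<tau>) = x powr (p - q)" .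
    have "(\<integral>\<^sup>+l. ennreal (2 powr (d * of_int l * (q / p - 1))) *
        ennpowr (if ennreal (2 powr (- d * of_int l / p)) < t then 0 else t) q \<partial>count_space UNIV)
        = (\<integral>\<^sup>+l. ennreal (2 powr (c * of_int l)) * indicator {l. real_of_int l \<le> \<tau>} l * ennpowr t q \<partial>count_space UNIV)"
      unfolding iff c by (intro nn_integral_cong) (auto simp: indicator_def)
    also have "\<dots> \<le> ennreal (x powr (p - q) / (1 - 2 powr (- c))) * ennpowr t q"
      using geometric_sum_int_le[OF \<open>0 < c\<close>, of \<tau>, unfolded \<tau>]
      by (subst nn_integral_multc) (auto intro!: mult_right_mono)
    also have "\<dots> = ennreal (1 / (1 - 2 powr (- c)) * x powr p)"
    proof -
      have "x powr (p - q) * x powr q = x powr p"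
        using 3 by (simp add: powr_add[symmetric])
      then show ?thesis
        using 3 by (simp add: ennpowr_ennreal ennreal_mult''[symmetric])
    qed
    also have "\<dots> = ennreal (1 / (1 - 2 powr (- d * (q / p - 1)))) * ennpowr t p"
      by (simp only: 3(1) ennpowr_ennreal[OF less_imp_le[OF 3(2)]] ennreal_mult''[OF powr_ge_zero]
          c_def minus_mult_left)
    finally show ?thesis .
  next
    case 2
    have "0 < 1 / (1 - 2 powr (- d * (q / p - 1)))"
      using assms by (auto simp: field_simps intro!: powr_less_one)
    then have "ennreal (1 / (1 - 2 powr (- d * (q / p - 1)))) \<noteq> 0"
      by (metis ennreal_eq_0_iff not_le)
    then show ?thesis
      using 2 by (simp add: ennreal_mult_top del: ennreal_eq_0_iff)
  qed simp
qed

text \<open>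
  At the scale where the boxes have volume \<open>V\<close>, the function is cut at height \<open>V\<^bsup>-1/p\<^esup>\<close>. The high part has
  coefficients at most 1, whose \<open>q\<close>-th powers are bounded by the coefficients themselves; the low part is
  handled by Jensen's inequality. In both cases the sum over the scales is geometric at every point.
\<close>

lemma dyadic_Carleson_embedding_normalized:
  fixes f :: "real^'n \<Rightarrow> ennreal"
  assumes "1 < p" "p < q" and [measurable]: "f \<in> borel_measurable borel"
    and norm: "(\<integral>\<^sup>+x. ennpowr (f x) p \<partial>lborel) = 1"
  shows "(\<integral>\<^sup>+s. ennpowr (\<integral>\<^sup>+x. dyadic_kernel p s x * f x \<partial>lborel) q \<partial>count_space UNIV)
    \<le> ennreal (2 powr q) * 3 ^ CARD('n) * (ennreal (1 / (1 - 2 powr (- real CARD('n) * (q / p - 1))))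
        + ennreal (1 / (1 - 2 powr (- real CARD('n) * (1 - 1 / p)))))"
proof -
  define d where "d = real CARD('n)"
  define C1 where "C1 = ennreal (1 / (1 - 2 powr (- d * (1 - 1 / p))))"
  define C2 where "C2 = ennreal (1 / (1 - 2 powr (- d * (q / p - 1))))"
  have d: "0 < d"
    by (simp add: d_def)
  define V :: "int \<Rightarrow> real" where "V l = 2 powr (d * of_int l)" for l
  have V: "0 < V l" "measure lebesgue (dyadic_box (l, z) :: (real^'n) set) = V l"
      "emeasure lborel (dyadic_box (l, z) :: (real^'n) set) = ennreal (V l)" for l and z :: "'n \<Rightarrow> int"
    by (simp_all add: V_def d_def measure_dyadic_box)
  have Vpowr: "V l powr a = 2 powr (d * of_int l * a)" for l a
    by (simp add: V_def powr_powr)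
  define hi where "hi l x = (if ennreal (V l powr (- 1 / p)) < f x then f x else 0)" for l x
  define lo where "lo l x = (if ennreal (V l powr (- 1 / p)) < f x then 0 else f x)" for l x
  have [measurable]: "hi l \<in> borel_measurable borel" "lo l \<in> borel_measurable borel" for l
    unfolding hi_def lo_def by measurable
  have f: "f x = lo l x + hi l x" for l x
    by (simp add: hi_def lo_def)
  define avg :: "(real^'n \<Rightarrow> ennreal) \<Rightarrow> int \<Rightarrow> ('n \<Rightarrow> int) \<Rightarrow> ennreal" where
    "avg g l z = ennreal (V l powr (1 / p - 1)) * (\<integral>\<^sup>+y. indicator (dyadic_box (l, z)) y * g y \<partial>lborel)" for g l z
  have avg: "(\<integral>\<^sup>+x. dyadic_kernel p (l, z) x * g x \<partial>lborel) = avg g l z"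
    if [measurable]: "g \<in> borel_measurable borel" for g l z
    unfolding avg_def by (subst nn_integral_cmult[symmetric]) (auto simp: dyadic_kernel_def V mult.assoc)

  \<comment> \<open>Where \<open>f\<close> exceeds the cut, \<open>V powr (1 / p) * f\<close>
    exceeds 1; its power \<open>p - 1\<close> then gives
    \<open>f \<le> V powr (1 - 1 / p) * f powr p\<close>. In the coefficient the powers of
    \<open>V\<close> cancel and the normalised norm leaves 1.\<close>
  have hi_le_1: "avg (hi l) l z \<le> 1" for l z
  proof -
    have hi: "hi l x \<le> ennreal (V l powr (1 - 1 / p)) * ennpowr (f x) p" for x
    proof (cases "ennreal (V l powr (- 1 / p)) < f x")
      case True
      have exponent: "(1 - 1 / p) + - 1 / p * (p - 1) = 0"
        using assms by (simp add: field_simps)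
      have "1 = ennreal (V l powr ((1 - 1 / p) + - 1 / p * (p - 1)))"
        unfolding exponent using V(1)[of l] by simp
      also have "\<dots> = ennreal (V l powr (1 - 1 / p)) * ennpowr (ennreal (V l powr (- 1 / p))) (p - 1)"
        by (simp only: ennpowr_ennreal[OF powr_ge_zero] powr_powr powr_add ennreal_mult'[OF powr_ge_zero])
      also have "\<dots> \<le> ennreal (V l powr (1 - 1 / p)) * ennpowr (f x) (p - 1)"
        using True assms by (intro mult_left_mono ennpowr_mono) auto
      finally have "1 * f x \<le> ennreal (V l powr (1 - 1 / p)) * ennpowr (f x) (p - 1) * f x"
        by (rule mult_right_mono) simp
      also have "\<dots> = ennreal (V l powr (1 - 1 / p)) * ennpowr (f x) p"
        using ennpowr_add[of "f x" "p - 1" 1] by (simp add: mult.assoc)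
      finally show ?thesis
        using True by (simp add: hi_def)
    qed (simp add: hi_def)
    have "avg (hi l) l z \<le> ennreal (V l powr (1 / p - 1)) * (\<integral>\<^sup>+y. ennreal (V l powr (1 - 1 / p)) * ennpowr (f y) p \<partial>lborel)"
      unfolding avg_def using hi by (intro mult_left_mono nn_integral_mono) (auto split: split_indicator)
    also have "\<dots> = ennreal (V l powr (1 / p - 1)) * ennreal (V l powr (1 - 1 / p))"
      by (subst nn_integral_cmult) (auto simp: norm)
    also have "\<dots> = 1"
      using V(1)[of l] by (simp add: ennreal_mult[symmetric] powr_add[symmetric])
    finally show ?thesis .
  qed

  have hi: "(\<integral>\<^sup>+l. \<integral>\<^sup>+z. ennpowr (avg (hi l) l z) q \<partial>count_space UNIV \<partial>count_space UNIV) \<le> 3 ^ CARD('n) * C1"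
  proof -
    have "(\<integral>\<^sup>+z. ennpowr (avg (hi l) l z) q \<partial>count_space UNIV)
        \<le> 3 ^ CARD('n) * (\<integral>\<^sup>+y. ennreal (V l powr (1 / p - 1)) * hi l y \<partial>lborel)" for l
    proof -
      have "ennpowr (avg (hi l) l z) q \<le> avg (hi l) l z" for z
      proof -
        have "ennpowr (avg (hi l) l z) q = ennpowr (avg (hi l) l z) (q - 1) * avg (hi l) l z"
          using ennpowr_add[of "avg (hi l) l z" "q - 1" 1] by simp
        also have "\<dots> \<le> ennpowr 1 (q - 1) * avg (hi l) l z"
          using assms hi_le_1 by (intro mult_right_mono ennpowr_mono) auto
        finally show ?thesis by simp
      qed
      then have "(\<integral>\<^sup>+z. ennpowr (avg (hi l) l z) q \<partial>count_space UNIV) \<le> (\<integral>\<^sup>+z. avg (hi l) l z \<partial>count_space UNIV)"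
        by (intro nn_integral_mono) auto
      also have "\<dots> = ennreal (V l powr (1 / p - 1)) *
          (\<integral>\<^sup>+z. \<integral>\<^sup>+y. indicator (dyadic_box (l, z)) y * hi l y \<partial>lborel \<partial>count_space UNIV)"
        unfolding avg_def by (rule nn_integral_cmult) auto
      also have "\<dots> \<le> ennreal (V l powr (1 / p - 1)) * (3 ^ CARD('n) * (\<integral>\<^sup>+y. hi l y \<partial>lborel))"
        by (intro mult_left_mono nn_integral_dyadic_box_sum_le) auto
      finally show ?thesis
        by (simp add: nn_integral_cmult mult.left_commute)
    qed
    then have "(\<integral>\<^sup>+l. \<integral>\<^sup>+z. ennpowr (avg (hi l) l z) q \<partial>count_space UNIV \<partial>count_space UNIV)
        \<le> (\<integral>\<^sup>+l. 3 ^ CARD('n) * (\<integral>\<^sup>+y. ennreal (V l powr (1 / p - 1)) * hi l y \<partial>lborel) \<partial>count_space UNIV)"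
      by (intro nn_integral_mono) auto
    also have "\<dots> = 3 ^ CARD('n) * (\<integral>\<^sup>+y. \<integral>\<^sup>+l. ennreal (V l powr (1 / p - 1)) * hi l y \<partial>count_space UNIV \<partial>lborel)"
      by (subst nn_integral_count_space_nn_integral) (auto simp: nn_integral_cmult)
    also have "\<dots> \<le> 3 ^ CARD('n) * (\<integral>\<^sup>+y. C1 * ennpowr (f y) p \<partial>lborel)"
      using weighted_sum_high_levels[OF assms(1) d, folded C1_def]
      by (intro mult_left_mono nn_integral_mono) (auto simp: hi_def Vpowr)
    also have "\<dots> = 3 ^ CARD('n) * C1"
      by (simp add: nn_integral_cmult norm)
    finally show ?thesis .
  qed

  have lo: "(\<integral>\<^sup>+l. \<integral>\<^sup>+z. ennpowr (avg (lo l) l z) q \<partial>count_space UNIV \<partial>count_space UNIV) \<le> 3 ^ CARD('n) * C2"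
  proof -
    have "(\<integral>\<^sup>+z. ennpowr (avg (lo l) l z) q \<partial>count_space UNIV)
        \<le> 3 ^ CARD('n) * (\<integral>\<^sup>+y. ennreal (V l powr (q / p - 1)) * ennpowr (lo l y) q \<partial>lborel)" for l
    proof -
      have "ennpowr (avg (lo l) l z) q \<le> ennreal (V l powr (q / p - 1)) *
          (\<integral>\<^sup>+y. indicator (dyadic_box (l, z)) y * ennpowr (lo l y) q \<partial>lborel)" for z
      proof -
        \<comment> \<open>Jensen contributes \<open>V powr (q - 1)\<close>, which combines with the
          \<open>q\<close>-th power of the kernel factor to
          \<open>V powr (q / p - 1)\<close>.\<close>
        have "ennpowr (avg (lo l) l z) q \<le> ennpowr (ennreal (V l powr (1 / p - 1))) q *
            (ennpowr (emeasure lborel (dyadic_box (l, z))) (q - 1) *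
             (\<integral>\<^sup>+y. indicator (dyadic_box (l, z)) y * ennpowr (lo l y) q \<partial>lborel))"
          unfolding avg_def ennpowr_mult
          using assms by (intro mult_left_mono nn_integral_Jensen_powr) auto
        also have "ennpowr (ennreal (V l powr (1 / p - 1))) q * (ennpowr (emeasure lborel (dyadic_box (l, z))) (q - 1) * A)
            = ennreal (V l powr (q / p - 1)) * A" for A
        proof -
          have exponent: "q / p - 1 = (1 / p - 1) * q + (q - 1)"
            by (simp add: algebra_simps)
          show ?thesis
            unfolding exponent powr_add V(3)
            by (simp only: ennpowr_ennreal[OF powr_ge_zero] ennpowr_ennreal[OF less_imp_le[OF V(1)]]
                powr_powr ennreal_mult'[OF powr_ge_zero] mult.assoc)
        qed
        finally show ?thesis .
      qed
      then have "(\<integral>\<^sup>+z. ennpowr (avg (lo l) l z) q \<partial>count_space UNIV)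
          \<le> (\<integral>\<^sup>+z. ennreal (V l powr (q / p - 1)) *
          (\<integral>\<^sup>+y. indicator (dyadic_box (l, z)) y * ennpowr (lo l y) q \<partial>lborel) \<partial>count_space UNIV)"
        by (intro nn_integral_mono) auto
      also have "\<dots> = ennreal (V l powr (q / p - 1)) *
          (\<integral>\<^sup>+z. \<integral>\<^sup>+y. indicator (dyadic_box (l, z)) y * ennpowr (lo l y) q \<partial>lborel \<partial>count_space UNIV)"
        by (rule nn_integral_cmult) auto
      also have "\<dots> \<le> ennreal (V l powr (q / p - 1)) * (3 ^ CARD('n) * (\<integral>\<^sup>+y. ennpowr (lo l y) q \<partial>lborel))"
        by (intro mult_left_mono nn_integral_dyadic_box_sum_le) auto
      finally show ?thesis
        by (simp add: nn_integral_cmult mult.left_commute)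
    qed
    then have "(\<integral>\<^sup>+l. \<integral>\<^sup>+z. ennpowr (avg (lo l) l z) q \<partial>count_space UNIV \<partial>count_space UNIV)
        \<le> (\<integral>\<^sup>+l. 3 ^ CARD('n) * (\<integral>\<^sup>+y. ennreal (V l powr (q / p - 1)) * ennpowr (lo l y) q \<partial>lborel) \<partial>count_space UNIV)"
      by (intro nn_integral_mono) auto
    also have "\<dots> = 3 ^ CARD('n) * (\<integral>\<^sup>+y. \<integral>\<^sup>+l. ennreal (V l powr (q / p - 1)) * ennpowr (lo l y) q \<partial>count_space UNIV \<partial>lborel)"
      by (subst nn_integral_count_space_nn_integral) (auto simp: nn_integral_cmult)
    also have "\<dots> \<le> 3 ^ CARD('n) * (\<integral>\<^sup>+y. C2 * ennpowr (f y) p \<partial>lborel)"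
      using weighted_sum_low_levels[OF assms(1,2) d, folded C2_def]
      by (intro mult_left_mono nn_integral_mono) (auto simp: lo_def Vpowr)
    also have "\<dots> = 3 ^ CARD('n) * C2"
      by (simp add: nn_integral_cmult norm)
    finally show ?thesis .
  qed

  have "(\<integral>\<^sup>+s. ennpowr (\<integral>\<^sup>+x. dyadic_kernel p s x * f x \<partial>lborel) q \<partial>count_space UNIV)
      = (\<integral>\<^sup>+l. \<integral>\<^sup>+z. ennpowr (avg f l z) q \<partial>count_space UNIV \<partial>count_space UNIV)"
    by (subst nn_integral_fst_count_space[symmetric]) (simp add: avg)
  also have "\<dots> \<le> (\<integral>\<^sup>+l. \<integral>\<^sup>+z. ennreal (2 powr q) * (ennpowr (avg (lo l) l z) q + ennpowr (avg (hi l) l z) q)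
      \<partial>count_space UNIV \<partial>count_space UNIV)"
  proof (intro nn_integral_mono)
    fix l z
    have "f = (\<lambda>y. lo l y + hi l y)"
      using f by blast
    then have "avg f l z = avg (\<lambda>y. lo l y + hi l y) l z"
      by (rule arg_cong)
    also have "\<dots> = avg (lo l) l z + avg (hi l) l z"
      unfolding avg_def by (simp add: distrib_left nn_integral_add)
    finally have "avg f l z = avg (lo l) l z + avg (hi l) l z" .
    then show "ennpowr (avg f l z) q \<le> ennreal (2 powr q) * (ennpowr (avg (lo l) l z) q + ennpowr (avg (hi l) l z) q)"
      using ennpowr_add_le[of q] assms by simp
  qed
  also have "\<dots> = ennreal (2 powr q) *
      ((\<integral>\<^sup>+l. \<integral>\<^sup>+z. ennpowr (avg (lo l) l z) q \<partial>count_space UNIV \<partial>count_space UNIV) +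
       (\<integral>\<^sup>+l. \<integral>\<^sup>+z. ennpowr (avg (hi l) l z) q \<partial>count_space UNIV \<partial>count_space UNIV))"
    by (simp add: nn_integral_add nn_integral_cmult)
  also have "\<dots> \<le> ennreal (2 powr q) * (3 ^ CARD('n) * C2 + 3 ^ CARD('n) * C1)"
    by (intro mult_left_mono add_mono lo hi) auto
  finally show ?thesis
    by (simp add: C1_def C2_def d_def distrib_left mult.assoc)
qed

text \<open>Both sides are homogeneous of degree \<open>q\<close> in \<open>f\<close>, so dividing
  by the \<open>p\<close>-norm reduces to the normalised case; norms \<open>0\<close> and
  \<open>top\<close> are treated apart.\<close>

lemma dyadic_Carleson_embedding:
  assumes "1 < p" "p < q"
  obtains C :: real where "0 \<le> C" "\<And>f :: real^'n \<Rightarrow> ennreal. f \<in> borel_measurable borel \<Longrightarrow>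
    (\<integral>\<^sup>+s. ennpowr (\<integral>\<^sup>+x. dyadic_kernel p s x * f x \<partial>lborel) q \<partial>count_space UNIV)
      \<le> ennreal C * ennpowr (\<integral>\<^sup>+x. ennpowr (f x) p \<partial>lborel) (q / p)"
proof -
  define K where "K = ennreal (2 powr q) * 3 ^ CARD('n) *
      (ennreal (1 / (1 - 2 powr (- real CARD('n) * (q / p - 1))))
        + ennreal (1 / (1 - 2 powr (- real CARD('n) * (1 - 1 / p)))))"
  \<comment> \<open>The maximum with 1 keeps the constant nonzero, so that the right side is
    infinite whenever the norm is.\<close>
  define C where "C = max 1 (enn2real K)"
  have "K < top"
    by (simp add: K_def ennreal_mult_less_top power_less_top_ennreal)
  then have "K \<le> ennreal C"
    by (metis C_def ennreal_enn2real ennreal_leI max.cobounded2)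
  have "(\<integral>\<^sup>+s. ennpowr (\<integral>\<^sup>+x. dyadic_kernel p s x * f x \<partial>lborel) q \<partial>count_space UNIV)
      \<le> ennreal C * ennpowr (\<integral>\<^sup>+x. ennpowr (f x) p \<partial>lborel) (q / p)"
    if [measurable]: "f \<in> borel_measurable borel" for f :: "real^'n \<Rightarrow> ennreal"
  proof -
    define N where "N = (\<integral>\<^sup>+x. ennpowr (f x) p \<partial>lborel)"
    have p: "0 < p" "0 < q" "1 / p * q = q / p"
      using assms by auto
    consider "N = 0" | "N = top" | "N \<noteq> 0" "N \<noteq> top"
      by blast
    then show ?thesis
    proof cases
      case 1
      then have "AE x in lborel. f x = 0"
        by (simp add: N_def nn_integral_0_iff_AE)
      then have "AE x in lborel. dyadic_kernel p s x * f x = 0" for s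
        by eventually_elim simp
      then have "(\<integral>\<^sup>+x. dyadic_kernel p s x * f x \<partial>lborel) = 0" for s
        by (subst nn_integral_0_iff_AE) (auto simp: dyadic_kernel_def)
      then show ?thesis
        by simp
    next
      case 2
      then show ?thesis
        by (simp add: N_def[symmetric] C_def ennreal_mult_top)
    next
      case 3
      define c where "c = ennpowr N (1 / p)"
      have c: "c \<noteq> 0" "c \<noteq> top" "ennpowr c p = N" "ennpowr c q = ennpowr N (q / p)"
        using 3 p by (auto simp: c_def ennpowr_inverse' ennpowr_ennpowr)
      define g where "g x = f x / c" for x
      have [measurable]: "g \<in> borel_measurable borel"
        unfolding g_def by measurable
      have f: "f x = c * g x" for x
        using c by (simp add: g_def ennreal_times_divide mult.commute[of c] ennreal_mult_divide_eq)
      have "N = (\<integral>\<^sup>+x. N * ennpowr (g x) p \<partial>lborel)"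
        unfolding c(3)[symmetric] ennpowr_mult[symmetric] f[symmetric] by (simp add: c(3) N_def)
      also have "\<dots> = N * (\<integral>\<^sup>+x. ennpowr (g x) p \<partial>lborel)"
        by (rule nn_integral_cmult) measurable
      finally have "N * (\<integral>\<^sup>+x. ennpowr (g x) p \<partial>lborel) = N * 1"
        by simp
      then have "(\<integral>\<^sup>+x. ennpowr (g x) p \<partial>lborel) = 1"
        using 3 by (subst (asm) ennreal_mult_cancel_left) auto
      then have "(\<integral>\<^sup>+s. ennpowr (\<integral>\<^sup>+x. dyadic_kernel p s x * g x \<partial>lborel) q \<partial>count_space UNIV) \<le> ennreal C"
        using dyadic_Carleson_embedding_normalized[OF assms, of g]  \<open>K \<le> ennreal C\<close>
        unfolding K_def[symmetric] by auto
      moreover have "(\<integral>\<^sup>+x. dyadic_kernel p s x * f x \<partial>lborel) = c * (\<integral>\<^sup>+x. dyadic_kernel p s x * g x \<partial>lborel)" for s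
        unfolding f by (subst nn_integral_cmult[symmetric]) (auto simp: dyadic_kernel_def mult_ac)
      ultimately show ?thesis
        by (simp add: ennpowr_mult c nn_integral_cmult N_def[symmetric] mult.commute[of "ennreal C"] mult_left_mono)
    qed
  qed
  then show ?thesis
    using that[of C] by (auto simp: C_def)
qed

subsection \<open>The strong fractional maximal operator\<close>

text \<open>Integrability on closed balls makes the restrictions of \<open>w\<close> to growing
  balls measurable, and at each point these are eventually equal to \<open>w\<close>.\<close>

lemma is_weight_borel_measurable:
  assumes "is_weight w"
  shows "w \<in> borel_measurable lebesgue"
proof (rule borel_measurable_LIMSEQ_real)
  show "(\<lambda>x. indicat_real (cball 0 (real n)) x *\<^sub>R w x) \<in> borel_measurable lebesgue" for n
    using assms unfolding is_weight_def set_integrable_def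
    by (intro borel_measurable_integrable) auto
  show "(\<lambda>n. indicat_real (cball 0 (real n)) x *\<^sub>R w x) \<longlonglongrightarrow> w x" for x
  proof (rule tendsto_eventually)
    obtain N :: nat where "norm x \<le> real N"
      using real_arch_simple by blast
    then show "\<forall>\<^sub>F n in sequentially. indicat_real (cball 0 (real n)) x *\<^sub>R w x = w x"
      by (intro eventually_sequentiallyI[of N]) (auto simp: indicator_def)
  qed
qed

lemma cubes_borel: "Q \<in> cubes \<Longrightarrow> Q \<in> sets borel"
  by (auto simp: cubes_def)

lemma measure_cubes_pos: "Q \<in> cubes \<Longrightarrow> 0 < measure lebesgue Q"
  by (auto simp: cubes_def measure_cube(1) less_imp_le simp del: measure_completion)

lemma emeasure_cubes: "Q \<in> cubes \<Longrightarrow> emeasure lebesgue Q = ennreal (measure lebesgue Q)"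
  by (auto simp: cubes_def measure_cube less_imp_le simp del: measure_completion emeasure_completion)

section \<open>Products of dyadic boxes and the embedding for several blocks\<close>

definition dyadic_block :: "('k \<Rightarrow> int \<times> ('n::finite \<Rightarrow> int)) \<Rightarrow> (real^'n^'k) set" where
  "dyadic_block \<sigma> = block_prod (\<lambda>j. dyadic_box (\<sigma> j))"

lemma dyadic_block_borel [measurable]: "dyadic_block (\<sigma> :: 'k::finite \<Rightarrow> _) \<in> sets borel"
  unfolding dyadic_block_def by measurable

lemma dyadic_block_lebesgue [measurable]: "dyadic_block (\<sigma> :: 'k::finite \<Rightarrow> _) \<in> sets lebesgue"
  by (simp add: sets_completionI_sets)

lemma dyadic_kernel_prod:
  fixes x :: "real^'n^'k"
  shows "(\<Prod>j\<in>UNIV. dyadic_kernel p (\<sigma> j) (x $ j))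
    = ennreal (\<Prod>j\<in>UNIV. measure lebesgue (dyadic_box (\<sigma> j) :: (real^'n) set) powr (1 / p - 1)) *
      indicator (dyadic_block \<sigma>) x"
  by (auto simp: dyadic_kernel_def prod.distrib prod_ennreal dyadic_block_def block_prod_def
      split: split_indicator simp del: measure_completion intro!: prod_zero)

text \<open>The product kernel bound with counting measure on the box indices and Lebesgue measure
  on a single block; each block contributes one factor of the constant.\<close>

lemma strong_dyadic_Carleson_embedding:
  assumes "1 < p" "p < q"
  shows "\<exists>C::real. 0 \<le> C \<and> ( \<forall>f \<in> borel_measurable (lebesgue :: (real^'n^'k) measure).
    (\<integral>\<^sup>+\<sigma>. ennpowr (ennreal (\<Prod>j\<in>UNIV. measure lebesgue (dyadic_box (\<sigma> j) :: (real^'n) set) powr (1 / p - 1)) *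
        (\<integral>\<^sup>+y\<in>dyadic_block \<sigma>. f y \<partial>lebesgue)) q \<partial>count_space UNIV)
      \<le> ennreal C * ennpowr (\<integral>\<^sup>+y. ennpowr (f y) p \<partial>lebesgue) (q / p))"
proof -
  obtain C where "0 \<le> C" and C: "\<And>f :: real^'n \<Rightarrow> ennreal. f \<in> borel_measurable borel \<Longrightarrow>
    (\<integral>\<^sup>+s. ennpowr (\<integral>\<^sup>+x. dyadic_kernel p s x * f x \<partial>lborel) q \<partial>count_space UNIV)
      \<le> ennreal C * ennpowr (\<integral>\<^sup>+x. ennpowr (f x) p \<partial>lborel) (q / p)"
    using dyadic_Carleson_embedding[OF assms] by blast
  let ?V = "\<lambda>\<sigma>. \<Prod>j\<in>UNIV. measure lebesgue (dyadic_box (\<sigma> j) :: (real^'n) set) powr (1 / p - 1)"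
  have "(\<integral>\<^sup>+\<sigma>. ennpowr (ennreal (?V \<sigma>) * (\<integral>\<^sup>+y\<in>dyadic_block \<sigma>. f y \<partial>lebesgue)) q \<partial>count_space UNIV)
      \<le> ennreal (C ^ CARD('k)) * ennpowr (\<integral>\<^sup>+y. ennpowr (f y) p \<partial>lebesgue) (q / p)"
    if f: "f \<in> borel_measurable lebesgue" for f :: "real^'n^'k \<Rightarrow> ennreal"
  proof -
    \<comment> \<open>Product measures see Borel functions only, so \<open>f\<close> is replaced by
      a Borel function that agrees with it almost everywhere.\<close>
    obtain g where [measurable]: "g \<in> borel_measurable lborel" and fg: "AE x in lborel. f x = g x"
      using completion_ex_borel_measurable[OF f] by blast
    \<comment> \<open>Identifies the sum over index tuples with an integral over a product of
      counting measures.\<close>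
    have PiM_count: "PiM (UNIV :: 'k set) (\<lambda>_. count_space (UNIV :: (int \<times> ('n \<Rightarrow> int)) set)) = count_space UNIV"
      using count_space_PiM_finite[of "UNIV :: 'k set" "\<lambda>_. UNIV :: (int \<times> ('n \<Rightarrow> int)) set"] by simp
    have V: "ennreal (?V \<sigma>) * (\<integral>\<^sup>+y\<in>dyadic_block \<sigma>. f y \<partial>lebesgue)
        = (\<integral>\<^sup>+x. (\<Prod>j\<in>UNIV. dyadic_kernel p (\<sigma> j) (x j)) * g (\<chi> j. x j) \<partial>PiM UNIV (\<lambda>_. lborel))" for \<sigma>
    proof -
      have "(\<integral>\<^sup>+y\<in>dyadic_block \<sigma>. f y \<partial>lebesgue) = (\<integral>\<^sup>+y\<in>dyadic_block \<sigma>. g y \<partial>lborel)"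
        unfolding nn_integral_completion using fg by (intro nn_integral_cong_AE) auto
      then have "ennreal (?V \<sigma>) * (\<integral>\<^sup>+y\<in>dyadic_block \<sigma>. f y \<partial>lebesgue)
          = (\<integral>\<^sup>+y. (\<Prod>j\<in>UNIV. dyadic_kernel p (\<sigma> j) (y $ j)) * g y \<partial>lborel)"
        unfolding dyadic_kernel_prod by (simp add: nn_integral_multc[symmetric] mult_ac del: measure_completion)
      also have "\<dots> = (\<integral>\<^sup>+x. (\<Prod>j\<in>UNIV. dyadic_kernel p (\<sigma> j) (x j)) * g (\<chi> j. x j) \<partial>PiM UNIV (\<lambda>_. lborel))"
        by (subst nn_integral_lborel_vec) (auto simp: dyadic_kernel_prod)
      finally show ?thesis .
    qed
    have "(\<integral>\<^sup>+\<sigma>. ennpowr (ennreal (?V \<sigma>) * (\<integral>\<^sup>+y\<in>dyadic_block \<sigma>. f y \<partial>lebesgue)) q \<partial>count_space UNIV)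
        \<le> ennreal C ^ CARD('k) * ennpowr (\<integral>\<^sup>+x. ennpowr (g (\<chi> j. x j)) p \<partial>PiM UNIV (\<lambda>_. lborel)) (q / p)"
      unfolding V PiM_count[symmetric]
      by (rule nn_integral_product_kernel_le)
         (use assms C in \<open>auto intro: sigma_finite_measure_count_space_countable sigma_finite_lborel\<close>)
    also have "(\<integral>\<^sup>+x. ennpowr (g (\<chi> j. x j)) p \<partial>PiM UNIV (\<lambda>_. lborel)) = (\<integral>\<^sup>+y. ennpowr (g y) p \<partial>lborel)"
      by (rule nn_integral_lborel_vec[symmetric]) simp
    also have "\<dots> = (\<integral>\<^sup>+y. ennpowr (f y) p \<partial>lebesgue)"
      unfolding nn_integral_completion using fg by (intro nn_integral_cong_AE) auto
    finally show ?thesis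
      using \<open>0 \<le> C\<close> by (simp add: ennreal_power)
  qed
  then show ?thesis
    using \<open>0 \<le> C\<close> by (intro exI[of _ "C ^ CARD('k)"] conjI ballI) auto
qed

text \<open>Each admissible product of cubes lies in a dyadic product with sides of comparable
  volume, whose term alone is dominated by the sum. Enlarging the cubes costs the factor
  \<open>(4 ^ CARD('n)) powr \<beta> j\<close> in block \<open>j\<close>.\<close>

lemma strong_frac_max_powr_le_dyadic_sum:
  fixes f :: "'m::finite \<Rightarrow> real^'n^'k \<Rightarrow> real" and \<alpha> :: "'k \<Rightarrow> real"
  assumes "0 < q" and \<alpha>: "\<And>j. \<alpha> j < CARD('m) * CARD('n)"
  shows "ennpowr (strong_frac_max \<alpha> f x) q \<le>
    (\<integral>\<^sup>+\<sigma>. ennpowr (ennreal ((4 ^ CARD('n)) powr (\<Sum>j\<in>UNIV. CARD('m) - \<alpha> j / CARD('n))) *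
        (ennreal (\<Prod>j\<in>UNIV. measure lebesgue (dyadic_box (\<sigma> j) :: (real^'n) set) powr (\<alpha> j / CARD('n) - CARD('m))) *
        (\<Prod>i\<in>UNIV. \<integral>\<^sup>+y\<in>dyadic_block \<sigma>. ennreal \<bar>f i y\<bar> \<partial>lebesgue))) q * indicator (dyadic_block \<sigma>) x
      \<partial>count_space UNIV)"
    (is "_ \<le> (\<integral>\<^sup>+\<sigma>. ennpowr (?K * ?A \<sigma>) q * indicator (dyadic_block \<sigma>) x \<partial>count_space UNIV)")
proof -
  define \<beta> where "\<beta> j = CARD('m) - \<alpha> j / CARD('n)" for j
  have \<beta>: "0 < \<beta> j" for j
    using \<alpha>[of j] by (simp add: \<beta>_def pos_divide_less_eq)
  have "ennreal (1 / (\<Prod>j\<in>UNIV. measure lebesgue (Q j) powr \<beta> j)) *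
        (\<Prod>i\<in>UNIV. \<integral>\<^sup>+y\<in>block_prod Q. ennreal \<bar>f i y\<bar> \<partial>lebesgue)
      \<le> ennpowr (\<integral>\<^sup>+\<sigma>. ennpowr (?K * ?A \<sigma>) q * indicator (dyadic_block \<sigma>) x \<partial>count_space UNIV) (1 / q)"
    (is "?T \<le> ennpowr ?R _") if Q: "\<And>j. Q j \<in> cubes" and x: "x \<in> block_prod Q" for Q
  proof -
    have "\<exists>s. Q j \<subseteq> dyadic_box s \<and>
        measure lebesgue (dyadic_box s :: (real^'n) set) \<le> 4 ^ CARD('n) * measure lebesgue (Q j)" for j
      using cube_subset_dyadic_box[OF Q[of j]] by metis
    then obtain \<sigma> where \<sigma>: "\<And>j. Q j \<subseteq> dyadic_box (\<sigma> j)"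
        "\<And>j. measure lebesgue (dyadic_box (\<sigma> j) :: (real^'n) set) \<le> 4 ^ CARD('n) * measure lebesgue (Q j)"
      by metis
    have sub: "block_prod Q \<subseteq> dyadic_block \<sigma>"
      using \<sigma>(1) by (auto simp: dyadic_block_def block_prod_def)
    have "1 / (\<Prod>j\<in>UNIV. measure lebesgue (Q j) powr \<beta> j)
        = (\<Prod>j\<in>UNIV. measure lebesgue (Q j) powr - \<beta> j)"
      by (simp add: powr_minus_divide prod_dividef)
    also have "\<dots> \<le> (\<Prod>j\<in>UNIV. (4 ^ CARD('n)) powr \<beta> j * measure lebesgue (dyadic_box (\<sigma> j) :: (real^'n) set) powr - \<beta> j)"
    proof (intro prod_mono conjI)
      fix j
      define a where "a = measure lebesgue (Q j)"
      define b where "b = measure lebesgue (dyadic_box (\<sigma> j) :: (real^'n) set)"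
      define c :: real where "c = 4 ^ CARD('n)"
      have ab: "0 < a" "0 < b" "b \<le> c * a" "0 < c"
        using \<sigma>(2)[of j] measure_cubes_pos[OF Q[of j]] measure_cubes_pos[OF dyadic_box_cubes, of "\<sigma> j"]
        by (simp_all add: a_def b_def c_def del: measure_completion)
      have "a powr - \<beta> j = c powr \<beta> j * (c * a) powr - \<beta> j"
        using ab by (simp add: powr_mult powr_minus field_simps)
      \<comment> \<open>\<open>\<alpha> j < CARD('m) * CARD('n)\<close> makes
        \<open>\<beta> j\<close> positive, so the power \<open>- \<beta> j\<close> is
        decreasing.\<close>
      also have "\<dots> \<le> c powr \<beta> j * b powr - \<beta> j"
        using ab \<beta>[of j] by (intro mult_left_mono powr_mono2') auto
      finally show "measure lebesgue (Q j) powr - \<beta> j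
          \<le> (4 ^ CARD('n)) powr \<beta> j * measure lebesgue (dyadic_box (\<sigma> j) :: (real^'n) set) powr - \<beta> j"
        by (simp add: a_def b_def c_def)
    qed simp
    also have "\<dots> = (4 ^ CARD('n)) powr (\<Sum>j\<in>UNIV. \<beta> j) *
        (\<Prod>j\<in>UNIV. measure lebesgue (dyadic_box (\<sigma> j) :: (real^'n) set) powr - \<beta> j)"
      by (simp add: prod.distrib powr_sum)
    finally have "ennreal (1 / (\<Prod>j\<in>UNIV. measure lebesgue (Q j) powr \<beta> j)) \<le>
        ennreal ((4 ^ CARD('n)) powr (\<Sum>j\<in>UNIV. \<beta> j)) *
        ennreal (\<Prod>j\<in>UNIV. measure lebesgue (dyadic_box (\<sigma> j) :: (real^'n) set) powr - \<beta> j)"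
      by (subst ennreal_mult'[symmetric]) (auto intro!: ennreal_leI)
    moreover have "(\<Prod>i\<in>UNIV. \<integral>\<^sup>+y\<in>block_prod Q. ennreal \<bar>f i y\<bar> \<partial>lebesgue)
        \<le> (\<Prod>i\<in>UNIV. \<integral>\<^sup>+y\<in>dyadic_block \<sigma>. ennreal \<bar>f i y\<bar> \<partial>lebesgue)"
      using sub by (intro prod_mono_ennreal nn_integral_mono) (auto split: split_indicator)
    ultimately have "?T \<le> ennreal ((4 ^ CARD('n)) powr (\<Sum>j\<in>UNIV. \<beta> j)) *
        ennreal (\<Prod>j\<in>UNIV. measure lebesgue (dyadic_box (\<sigma> j) :: (real^'n) set) powr - \<beta> j) *
        (\<Prod>i\<in>UNIV. \<integral>\<^sup>+y\<in>dyadic_block \<sigma>. ennreal \<bar>f i y\<bar> \<partial>lebesgue)"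
      by (rule mult_mono) auto
    also have "\<dots> = ?K * ?A \<sigma>"
      by (simp add: \<beta>_def mult.assoc del: measure_completion)
    finally have "ennpowr ?T q \<le> ennpowr (?K * ?A \<sigma>) q * indicator (dyadic_block \<sigma>) x"
      using \<open>0 < q\<close> sub x by (simp add: ennpowr_mono subsetD del: measure_completion)
    also have "\<dots> \<le> ?R"
      by (rule nn_integral_ge_point) simp
    finally show ?thesis
      by (subst (asm) ennpowr_le_iff[OF \<open>0 < q\<close>])
  qed
  then show ?thesis
    unfolding ennpowr_le_iff[OF \<open>0 < q\<close>] strong_frac_max_def \<beta>_def by (intro SUP_least) auto
qed

section \<open>The testing condition: sufficiency and necessity\<close>

definition testing_constant :: "real \<Rightarrow> real \<Rightarrow> ('k::finite \<Rightarrow> real) \<Rightarrow> (real^'n^'k \<Rightarrow> real) \<Rightarrow> ennreal" where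
  "testing_constant p q \<alpha> u = (SUP Q \<in> {Q :: 'k \<Rightarrow> (real^'n) set. \<forall>j. Q j \<in> cubes}.
     (\<integral>\<^sup>+x\<in>block_prod Q. ennreal (u x powr q) \<partial>lebesgue) *
     ennreal (\<Prod>j\<in>UNIV. measure lebesgue (Q j) powr (q * (\<alpha> j / CARD('n) - 1 / p))))"

lemma testing_constant_upper:
  fixes Q :: "'k::finite \<Rightarrow> (real^'n) set"
  assumes "\<And>j. Q j \<in> cubes"
  shows "(\<integral>\<^sup>+x\<in>block_prod Q. ennreal (u x powr q) \<partial>lebesgue)
    \<le> testing_constant p q \<alpha> u * ennreal (\<Prod>j\<in>UNIV. measure lebesgue (Q j) powr (- q * (\<alpha> j / CARD('n) - 1 / p)))"
proof -
  define P where "P = (\<Prod>j\<in>UNIV. measure lebesgue (Q j) powr (q * (\<alpha> j / CARD('n) - 1 / p)))"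
  define P' where "P' = (\<Prod>j\<in>UNIV. measure lebesgue (Q j) powr (- q * (\<alpha> j / CARD('n) - 1 / p)))"
  have "P * P' = (\<Prod>j\<in>(UNIV :: 'k set). 1)"
    unfolding P_def P'_def prod.distrib[symmetric]
    using measure_cubes_pos[OF assms] by (intro prod.cong) (auto simp: powr_add[symmetric] less_imp_neq[symmetric] simp del: measure_completion)
  moreover have "0 \<le> P" "0 \<le> P'"
    by (auto simp: P_def P'_def intro!: prod_nonneg)
  ultimately have PP': "ennreal P * ennreal P' = 1"
    by (simp add: ennreal_mult[symmetric])
  let ?U = "\<integral>\<^sup>+x\<in>block_prod Q. ennreal (u x powr q) \<partial>lebesgue"
  have "?U * ennreal P \<le> testing_constant p q \<alpha> u"
    unfolding testing_constant_def P_def using assms by (intro SUP_upper) auto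
  then have "?U * ennreal P * ennreal P' \<le> testing_constant p q \<alpha> u * ennreal P'"
    by (rule mult_right_mono) simp
  then show ?thesis
    using PP' by (simp add: mult.assoc P'_def)
qed

text \<open>The supremum is replaced by a sum pointwise, before integrating. Hence the weight enters
  only through its mass on each dyadic product, which is what the testing constant controls.\<close>

lemma strong_frac_max_bounded_if_testing:
  fixes ps :: "'m::finite \<Rightarrow> real" and p q :: real
    and \<alpha> :: "'k::finite \<Rightarrow> real"
    and u :: "real^'n^'k \<Rightarrow> real"
  assumes ps: "\<And>i. 1 < ps i"
    and p: "1 / p = (\<Sum>i\<in>UNIV. 1 / ps i)"
    and "p < q"
    and \<alpha>: "\<And>j. \<alpha> j < CARD('m) * CARD('n)"
    and u: "AE x in lebesgue. 0 < u x" "is_weight (\<lambda>x. u x powr q)"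
    and test: "testing_constant p q \<alpha> u < \<infinity>"
  shows "\<exists>c::real. 0 < c \<and> (\<forall>f :: 'm \<Rightarrow> real^'n^'k \<Rightarrow> real. (\<forall>i. f i \<in> borel_measurable lebesgue) \<longrightarrow>
     lp_norm q (\<lambda>x. ennreal \<bar>u x\<bar> * strong_frac_max \<alpha> f x)
       \<le> ennreal c * (\<Prod>i\<in>UNIV. lp_norm (ps i) (\<lambda>x. ennreal \<bar>f i x\<bar>)))"
proof -
  have ps0: "0 < ps i" for i
    using ps[of i] by simp
  have "0 < 1 / p"
    unfolding p using ps0 by (intro sum_pos) auto
  then have "0 < p" "0 < q"
    using \<open>p < q\<close> by auto
  define \<theta> where "\<theta> i = p / ps i" for i
  have \<theta>: "0 < \<theta> i" for i
    using ps0 \<open>0 < p\<close> by (simp add: \<theta>_def)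
  have \<theta>_sum: "sum \<theta> UNIV = 1"
  proof -
    have "sum \<theta> UNIV = p * (\<Sum>i\<in>UNIV. 1 / ps i)"
      by (simp add: \<theta>_def sum_distrib_left)
    then show ?thesis
      using p[symmetric] \<open>0 < p\<close> by simp
  qed
  \<comment> \<open>Chosen so that the Hoelder weight \<open>\<theta> i\<close> turns the power
    \<open>qs i\<close> into \<open>q\<close>, while \<open>p < q\<close> still gives
    \<open>ps i < qs i\<close>. The ratio \<open>qs i / ps i\<close> is the same for all
    \<open>i\<close>.\<close>
  define qs where "qs i = q * ps i / p" for i
  have qs: "ps i < qs i" "qs i * \<theta> i = q" "qs i / ps i = q / p" for i
    using \<open>0 < p\<close> \<open>p < q\<close> ps0[of i] by (auto simp: qs_def \<theta>_def field_simps)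
  let ?v = "\<lambda>(\<sigma> :: 'k \<Rightarrow> int \<times> ('n \<Rightarrow> int)) j. measure lebesgue (dyadic_box (\<sigma> j) :: (real^'n) set)"
  have v: "0 < ?v \<sigma> j" for \<sigma> j
    by (rule measure_cubes_pos) (rule dyadic_box_cubes)
  let ?a = "\<lambda>i (f :: real^'n^'k \<Rightarrow> ennreal) \<sigma>. ennreal (\<Prod>j\<in>UNIV. ?v \<sigma> j powr (1 / ps i - 1)) * (\<integral>\<^sup>+y\<in>dyadic_block \<sigma>. f y \<partial>lebesgue)"
  have "\<forall>i. \<exists>C::real. 0 \<le> C \<and> (\<forall>f \<in> borel_measurable (lebesgue :: (real^'n^'k) measure).
    (\<integral>\<^sup>+\<sigma>. ennpowr (?a i f \<sigma>) (qs i) \<partial>count_space UNIV)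
      \<le> ennreal C * ennpowr (\<integral>\<^sup>+y. ennpowr (f y) (ps i) \<partial>lebesgue) (q / p))"
    using strong_dyadic_Carleson_embedding[OF ps qs(1), unfolded qs(3)] by (rule allI)
  from choice[OF this] obtain C where C: "\<forall>i. 0 \<le> C i \<and> (\<forall>f \<in> borel_measurable (lebesgue :: (real^'n^'k) measure).
    (\<integral>\<^sup>+\<sigma>. ennpowr (?a i f \<sigma>) (qs i) \<partial>count_space UNIV)
      \<le> ennreal (C i) * ennpowr (\<integral>\<^sup>+y. ennpowr (f y) (ps i) \<partial>lebesgue) (q / p))" ..
  define K where "K = ennreal ((4 ^ CARD('n)) powr (\<Sum>j\<in>UNIV. CARD('m) - \<alpha> j / CARD('n)))"
  define T where "T = testing_constant p q \<alpha> u"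
  define c where "c = K * ennpowr T (1 / q) * (\<Prod>i\<in>UNIV. ennpowr (ennreal (C i)) (\<theta> i / q))"
  have "c < top"
  proof -
    have "ennpowr T (1 / q) \<noteq> top"
      using test by (simp add: T_def)
    moreover have "(\<Prod>i\<in>UNIV. ennpowr (ennreal (C i)) (\<theta> i / q)) \<noteq> top"
      by (simp add: ennreal_prod_eq_top)
    ultimately have "c \<noteq> top"
      unfolding c_def K_def by (simp add: ennreal_mult_eq_top_iff)
    then show ?thesis
      by (simp add: less_top)
  qed
  have [measurable]: "(\<lambda>x. ennreal (u x powr q)) \<in> borel_measurable lebesgue"
    using is_weight_borel_measurable[OF u(2)] by simp
  have "lp_norm q (\<lambda>x. ennreal \<bar>u x\<bar> * strong_frac_max \<alpha> f x)
       \<le> c * (\<Prod>i\<in>UNIV. lp_norm (ps i) (\<lambda>x. ennreal \<bar>f i x\<bar>))"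
    if [measurable]: "\<And>i. f i \<in> borel_measurable lebesgue" for f :: "'m \<Rightarrow> real^'n^'k \<Rightarrow> real"
  proof -
    define F where "F i \<sigma> = (\<integral>\<^sup>+y\<in>dyadic_block \<sigma>. ennreal \<bar>f i y\<bar> \<partial>lebesgue)" for i \<sigma>
    define A where "A \<sigma> = ennreal (\<Prod>j\<in>UNIV. ?v \<sigma> j powr (\<alpha> j / CARD('n) - CARD('m))) * (\<Prod>i\<in>UNIV. F i \<sigma>)" for \<sigma>
    have "(\<integral>\<^sup>+x. ennpowr (ennreal \<bar>u x\<bar> * strong_frac_max \<alpha> f x) q \<partial>lebesgue)
        \<le> (\<integral>\<^sup>+x. (\<integral>\<^sup>+\<sigma>. ennpowr (K * A \<sigma>) q * (ennreal (u x powr q) * indicator (dyadic_block \<sigma>) x) \<partial>count_space UNIV) \<partial>lebesgue)"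
      using u(1)
    proof (intro nn_integral_mono_AE, eventually_elim)
      fix x assume "0 < u x"
      then have "ennpowr (ennreal \<bar>u x\<bar> * strong_frac_max \<alpha> f x) q
          = ennreal (u x powr q) * ennpowr (strong_frac_max \<alpha> f x) q"
        by (simp add: ennpowr_mult ennpowr_ennreal)
      also have "\<dots> \<le> ennreal (u x powr q) * (\<integral>\<^sup>+\<sigma>. ennpowr (K * A \<sigma>) q * indicator (dyadic_block \<sigma>) x \<partial>count_space UNIV)"
        unfolding K_def A_def F_def by (intro mult_left_mono strong_frac_max_powr_le_dyadic_sum \<open>0 < q\<close> \<alpha>) auto
      also have "\<dots> = (\<integral>\<^sup>+\<sigma>. ennpowr (K * A \<sigma>) q * (ennreal (u x powr q) * indicator (dyadic_block \<sigma>) x) \<partial>count_space UNIV)"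
        by (subst nn_integral_cmult[symmetric]) (auto simp: mult_ac)
      finally show "ennpowr (ennreal \<bar>u x\<bar> * strong_frac_max \<alpha> f x) q \<le> \<dots>" .
    qed
    \<comment> \<open>The tuples of box indices are countable, so the sum and the integral may be
      exchanged.\<close>
    also have "\<dots> = (\<integral>\<^sup>+\<sigma>. (\<integral>\<^sup>+x. ennpowr (K * A \<sigma>) q * (ennreal (u x powr q) * indicator (dyadic_block \<sigma>) x) \<partial>lebesgue) \<partial>count_space UNIV)"
      by (rule nn_integral_count_space_nn_integral) (simp, measurable)
    also have "\<dots> = (\<integral>\<^sup>+\<sigma>. ennpowr (K * A \<sigma>) q * (\<integral>\<^sup>+x\<in>dyadic_block \<sigma>. ennreal (u x powr q) \<partial>lebesgue) \<partial>count_space UNIV)"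
      by (intro nn_integral_cong nn_integral_cmult) measurable
    also have "\<dots> \<le> (\<integral>\<^sup>+\<sigma>. ennpowr (K * A \<sigma>) q * (T * ennreal (\<Prod>j\<in>UNIV. ?v \<sigma> j powr (- q * (\<alpha> j / CARD('n) - 1 / p)))) \<partial>count_space UNIV)"
      unfolding dyadic_block_def T_def
      by (intro nn_integral_mono mult_left_mono testing_constant_upper dyadic_box_cubes) auto
    also have "\<dots> = (\<integral>\<^sup>+\<sigma>. ennpowr K q * T * (\<Prod>i\<in>UNIV. ennpowr (?a i (\<lambda>y. ennreal \<bar>f i y\<bar>) \<sigma>) q) \<partial>count_space UNIV)"
    proof (intro nn_integral_cong)
      fix \<sigma>
      \<comment> \<open>The \<open>\<alpha> j\<close> cancel here; the remaining exponent is
        distributed over the functions by the relation that defines \<open>p\<close>.\<close>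
      have exponent: "(\<alpha> j / CARD('n) - CARD('m)) * q + - q * (\<alpha> j / CARD('n) - 1 / p) = (\<Sum>i\<in>UNIV. (1 / ps i - 1) * q)" for j
      proof -
        have "(\<Sum>i\<in>UNIV. (1 / ps i - 1) * q) = (1 / p - CARD('m)) * q"
          unfolding p sum_distrib_right[symmetric] by (simp add: sum_subtractf)
        then show ?thesis
          by (simp add: algebra_simps)
      qed
      have "ennpowr (ennreal (\<Prod>j\<in>UNIV. ?v \<sigma> j powr (\<alpha> j / CARD('n) - CARD('m)))) q *
          ennreal (\<Prod>j\<in>UNIV. ?v \<sigma> j powr (- q * (\<alpha> j / CARD('n) - 1 / p)))
          = ennreal (\<Prod>j\<in>UNIV. ?v \<sigma> j powr ((\<alpha> j / CARD('n) - CARD('m)) * q + - q * (\<alpha> j / CARD('n) - 1 / p)))"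
      proof -
        have "ennpowr (ennreal (\<Prod>j\<in>UNIV. ?v \<sigma> j powr (\<alpha> j / CARD('n) - CARD('m)))) q
            = ennreal (\<Prod>j\<in>UNIV. ?v \<sigma> j powr ((\<alpha> j / CARD('n) - CARD('m)) * q))"
          by (simp add: ennpowr_ennreal prod_nonneg prod_powr_distrib powr_powr del: measure_completion)
        then show ?thesis
          unfolding powr_add prod.distrib by (simp only: ennreal_mult'[OF prod_nonneg[OF powr_ge_zero]])
      qed
      also have "\<dots> = ennreal (\<Prod>j\<in>UNIV. \<Prod>i\<in>UNIV. ?v \<sigma> j powr ((1 / ps i - 1) * q))"
        unfolding exponent using v[of \<sigma>] by (subst powr_sum) (auto simp: less_imp_neq[symmetric] simp del: measure_completion)
      also have "\<dots> = ennreal (\<Prod>i\<in>UNIV. (\<Prod>j\<in>UNIV. ?v \<sigma> j powr (1 / ps i - 1)) powr q)"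
        by (subst prod.swap) (simp add: prod_powr_distrib powr_powr del: measure_completion)
      also have "\<dots> = (\<Prod>i\<in>UNIV. ennpowr (ennreal (\<Prod>j\<in>UNIV. ?v \<sigma> j powr (1 / ps i - 1))) q)"
        by (simp add: ennpowr_ennreal prod_nonneg prod_ennreal del: measure_completion)
      finally have exponents: "ennpowr (ennreal (\<Prod>j\<in>UNIV. ?v \<sigma> j powr (\<alpha> j / CARD('n) - CARD('m)))) q *
          ennreal (\<Prod>j\<in>UNIV. ?v \<sigma> j powr (- q * (\<alpha> j / CARD('n) - 1 / p)))
          = (\<Prod>i\<in>UNIV. ennpowr (ennreal (\<Prod>j\<in>UNIV. ?v \<sigma> j powr (1 / ps i - 1))) q)" .
      have regroup: "a * (b * b') * (d * d') = a * d * (b * d' * b')" for a b b' d d' :: ennreal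
        by (simp only: mult_ac)
      show "ennpowr (K * A \<sigma>) q * (T * ennreal (\<Prod>j\<in>UNIV. ?v \<sigma> j powr (- q * (\<alpha> j / CARD('n) - 1 / p))))
          = ennpowr K q * T * (\<Prod>i\<in>UNIV. ennpowr (?a i (\<lambda>y. ennreal \<bar>f i y\<bar>) \<sigma>) q)"
        unfolding A_def ennpowr_mult ennpowr_prod prod.distrib F_def regroup exponents ..
    qed
    also have "\<dots> = ennpowr K q * T * (\<integral>\<^sup>+\<sigma>. (\<Prod>i\<in>UNIV. ennpowr (ennpowr (?a i (\<lambda>y. ennreal \<bar>f i y\<bar>) \<sigma>) (qs i)) (\<theta> i)) \<partial>count_space UNIV)"
      unfolding ennpowr_ennpowr qs(2) by (rule nn_integral_cmult) simp
    \<comment> \<open>Hoelder for the counting measure on the tuples: the sum of products becomes a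
      product of sums, one linear estimate for each function.\<close>
    also have "\<dots> \<le> ennpowr K q * T * (\<Prod>i\<in>UNIV. ennpowr (\<integral>\<^sup>+\<sigma>. ennpowr (?a i (\<lambda>y. ennreal \<bar>f i y\<bar>) \<sigma>) (qs i) \<partial>count_space UNIV) (\<theta> i))"
      by (intro mult_left_mono nn_integral_Hoelder \<theta> \<theta>_sum) auto
    also have "\<dots> \<le> ennpowr K q * T * (\<Prod>i\<in>UNIV. ennpowr (ennreal (C i) * ennpowr (\<integral>\<^sup>+y. ennpowr (ennreal \<bar>f i y\<bar>) (ps i) \<partial>lebesgue) (q / p)) (\<theta> i))"
      by (intro mult_left_mono prod_mono_ennreal ennpowr_mono C[rule_format, THEN conjunct2, rule_format]) (auto simp: less_imp_le \<theta>)
    finally have "lp_norm q (\<lambda>x. ennreal \<bar>u x\<bar> * strong_frac_max \<alpha> f x) \<le>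
        ennpowr (ennpowr K q * T * (\<Prod>i\<in>UNIV. ennpowr (ennreal (C i) * ennpowr (\<integral>\<^sup>+y. ennpowr (ennreal \<bar>f i y\<bar>) (ps i) \<partial>lebesgue) (q / p)) (\<theta> i))) (1 / q)"
      unfolding lp_norm_def using \<open>0 < q\<close> by (intro ennpowr_mono) auto
    also have "\<dots> = c * (\<Prod>i\<in>UNIV. lp_norm (ps i) (\<lambda>x. ennreal \<bar>f i x\<bar>))"
    proof -
      have "q / p * \<theta> i * (1 / q) = 1 / ps i" "\<theta> i * (1 / q) = \<theta> i / q" for i
        using \<open>0 < p\<close> \<open>0 < q\<close> by (simp_all add: \<theta>_def)
      then show ?thesis
        unfolding lp_norm_def c_def
        using \<open>0 < q\<close> by (simp add: ennpowr_mult ennpowr_prod ennpowr_ennpowr prod.distrib mult.assoc)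
    qed
    finally show ?thesis .
  qed
  \<comment> \<open>Adding 1 replaces the finite extended constant by a strictly positive real
    one.\<close>
  moreover have "c * P \<le> ennreal (enn2real c + 1) * P" for P
    using \<open>c < top\<close> by (intro mult_right_mono) (simp_all add: ennreal_plus)
  ultimately have "lp_norm q (\<lambda>x. ennreal \<bar>u x\<bar> * strong_frac_max \<alpha> f x)
       \<le> ennreal (enn2real c + 1) * (\<Prod>i\<in>UNIV. lp_norm (ps i) (\<lambda>x. ennreal \<bar>f i x\<bar>))"
    if "\<And>i. f i \<in> borel_measurable lebesgue" for f :: "'m \<Rightarrow> real^'n^'k \<Rightarrow> real"
    using that order_trans by blast
  then show ?thesis
    by (intro exI[of _ "enn2real c + 1"] conjI allI impI add_nonneg_pos) auto
qed

text \<open>For \<open>R = block_prod Q\<close> and every \<open>f i\<close> the indicator of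
  \<open>R\<close>, the set \<open>R\<close> competes in the supremum at each of its own points.
  This bounds the maximal function below by a constant on \<open>R\<close>, and only the mass of the
  weight on \<open>R\<close> is left on the left side.\<close>

lemma testing_if_strong_frac_max_bounded:
  fixes ps :: "'m::finite \<Rightarrow> real" and p q c :: real
    and \<alpha> :: "'k::finite \<Rightarrow> real"
    and u :: "real^'n^'k \<Rightarrow> real"
  assumes ps: "\<And>i. 0 < ps i"
    and p: "1 / p = (\<Sum>i\<in>UNIV. 1 / ps i)"
    and "0 < q"
    and u: "AE x in lebesgue. 0 < u x" "is_weight (\<lambda>x. u x powr q)"
    and bound: "\<And>f :: 'm \<Rightarrow> real^'n^'k \<Rightarrow> real. (\<And>i. f i \<in> lp_space (ps i)) \<Longrightarrow>
     lp_norm q (\<lambda>x. ennreal \<bar>u x\<bar> * strong_frac_max \<alpha> f x)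
       \<le> ennreal c * (\<Prod>i\<in>UNIV. lp_norm (ps i) (\<lambda>x. ennreal \<bar>f i x\<bar>))"
  shows "testing_constant p q \<alpha> u \<le> ennpowr (ennreal c) q"
  unfolding testing_constant_def
proof (intro SUP_least)
  fix Q :: "'k \<Rightarrow> (real^'n) set" assume "Q \<in> {Q. \<forall>j. Q j \<in> cubes}"
  then have Q: "\<And>j. Q j \<in> cubes"
    by simp
  define v where "v j = measure lebesgue (Q j)" for j
  have v: "0 < v j" for j
    using measure_cubes_pos[OF Q] by (simp add: v_def)
  define V where "V = (\<Prod>j\<in>UNIV. v j)"
  have "0 < V"
    using v by (auto simp: V_def intro!: prod_pos)
  define R where "R = block_prod Q"
  have [measurable]: "R \<in> sets borel"
    unfolding R_def using Q by (intro block_prod_borel cubes_borel)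
  then have R [measurable]: "R \<in> sets lebesgue"
    by (simp add: sets_completionI_sets)
  have emR: "emeasure lebesgue R = ennreal V"
    unfolding R_def V_def v_def using Q
    by (subst emeasure_lebesgue_block_prod)
       (simp_all add: cubes_borel emeasure_cubes prod_ennreal del: measure_completion emeasure_completion)
  define f :: "'m \<Rightarrow> real^'n^'k \<Rightarrow> real" where "f i = indicator R" for i
  have f: "ennreal \<bar>f i x\<bar> = indicator R x" for i x
    by (simp add: f_def split: split_indicator)
  have norm_f: "lp_norm (ps i) (\<lambda>x. ennreal \<bar>f i x\<bar>) = ennpowr (ennreal V) (1 / ps i)" for i
  proof -
    have "ennpowr (indicator R x) (ps i) = indicator R x" for x
      by (simp split: split_indicator)
    then show ?thesis
      unfolding lp_norm_def f using R by (simp add: emR del: emeasure_completion nn_integral_completion)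
  qed
  have "f i \<in> lp_space (ps i)" for i
    unfolding lp_space_def using norm_f[of i] R by (auto simp: f_def ennpowr_ennreal \<open>0 < V\<close> less_imp_le)
  define U where "U = (\<integral>\<^sup>+x\<in>R. ennreal (u x powr q) \<partial>lebesgue)"
  \<comment> \<open>The value of the term for \<open>R\<close> itself: the integrals give
    \<open>V ^ CARD('m)\<close>, of which the fractional denominator leaves
    \<open>v j powr (\<alpha> j / CARD('n))\<close> in block \<open>j\<close>.\<close>
  define W where "W = (\<Prod>j\<in>UNIV. v j powr (\<alpha> j / CARD('n)))"
  have "0 < W"
    using v by (auto simp: W_def less_imp_neq[symmetric] intro!: prod_pos)
  have W_le: "ennreal W \<le> strong_frac_max \<alpha> f x" if "x \<in> R" for x
  proof -
    have "W * (\<Prod>j\<in>UNIV. v j powr (CARD('m) - \<alpha> j / CARD('n))) = (\<Prod>j\<in>UNIV. v j powr CARD('m))"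
      unfolding W_def prod.distrib[symmetric] powr_add[symmetric] by simp
    also have "\<dots> = V ^ CARD('m)"
      using v by (simp add: V_def prod_power_distrib powr_realpow)
    finally have "W = 1 / (\<Prod>j\<in>UNIV. v j powr (CARD('m) - \<alpha> j / CARD('n))) * V ^ CARD('m)"
      using v by (simp add: field_simps less_imp_neq[symmetric])
    then have "ennreal W = ennreal (1 / (\<Prod>j\<in>UNIV. measure lebesgue (Q j) powr (CARD('m) - \<alpha> j / CARD('n)))) *
        (\<Prod>i\<in>(UNIV :: 'm set). \<integral>\<^sup>+y\<in>block_prod Q. ennreal \<bar>f i y\<bar> \<partial>lebesgue)"
      unfolding f R_def[symmetric] v_def[symmetric] using R \<open>0 < V\<close>
      by (simp add: emR ennreal_mult''[symmetric] ennreal_power indicator_inter_arith[symmetric] del: emeasure_completion nn_integral_completion)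
    also have "\<dots> \<le> strong_frac_max \<alpha> f x"
      unfolding strong_frac_max_def using Q that by (intro SUP_upper) (auto simp: R_def)
    finally show ?thesis .
  qed
  have [measurable]: "(\<lambda>x. ennreal (u x powr q)) \<in> borel_measurable lebesgue"
    using is_weight_borel_measurable[OF u(2)] by simp
  have "ennpowr (ennreal W) q * U = (\<integral>\<^sup>+x. ennpowr (ennreal W) q * (ennreal (u x powr q) * indicator R x) \<partial>lebesgue)"
    unfolding U_def by (rule nn_integral_cmult[symmetric]) measurable
  also have "\<dots> \<le> (\<integral>\<^sup>+x. ennpowr (ennreal \<bar>u x\<bar> * strong_frac_max \<alpha> f x) q \<partial>lebesgue)"
    using u(1)
  proof (intro nn_integral_mono_AE, eventually_elim)
    fix x assume "0 < u x"
    then have "ennpowr (ennreal \<bar>u x\<bar> * strong_frac_max \<alpha> f x) q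
        = ennpowr (strong_frac_max \<alpha> f x) q * ennreal (u x powr q)"
      by (simp add: ennpowr_mult ennpowr_ennreal mult.commute)
    moreover have "x \<in> R \<Longrightarrow> ennpowr (ennreal W) q \<le> ennpowr (strong_frac_max \<alpha> f x) q"
      using W_le[of x] \<open>0 < q\<close> by (intro ennpowr_mono) auto
    ultimately show "ennpowr (ennreal W) q * (ennreal (u x powr q) * indicator R x)
        \<le> ennpowr (ennreal \<bar>u x\<bar> * strong_frac_max \<alpha> f x) q"
      by (auto split: split_indicator intro: mult_right_mono)
  qed
  also have "\<dots> \<le> ennpowr (ennreal c * (\<Prod>i\<in>UNIV. ennpowr (ennreal V) (1 / ps i))) q"
    using bound[of f] \<open>\<And>i. f i \<in> lp_space (ps i)\<close> \<open>0 < q\<close>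
    unfolding norm_f lp_norm_def[of q] by (subst (asm) ennpowr_le_iff) auto
  also have "\<dots> = ennpowr (ennreal c) q * ennreal (V powr (q / p))"
  proof -
    have "(\<Prod>i\<in>UNIV. ennpowr (ennreal V) (1 / ps i)) = ennreal (V powr (1 / p))"
      unfolding p using \<open>0 < V\<close> by (simp add: ennpowr_ennreal prod_ennreal powr_sum)
    then show ?thesis
      using \<open>0 < V\<close> by (simp add: ennpowr_mult ennpowr_ennreal powr_powr)
  qed
  finally have *: "ennpowr (ennreal W) q * U \<le> ennpowr (ennreal c) q * ennreal (V powr (q / p))" .
  \<comment> \<open>The volume factor of the testing condition is the \<open>q\<close>-th power of
    the lower bound \<open>W\<close> times the inverse of \<open>V powr (q / p)\<close>, which came
    from the norms of the indicators.\<close>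
  have "(\<Prod>j\<in>UNIV. v j powr (q * (\<alpha> j / CARD('n) - 1 / p))) = W powr q * V powr (- q / p)"
  proof -
    have "v j powr (q * (\<alpha> j / CARD('n) - 1 / p)) = (v j powr (\<alpha> j / CARD('n))) powr q * v j powr (- q / p)" for j
      unfolding powr_powr powr_add[symmetric] by (simp add: algebra_simps)
    then show ?thesis
      using v by (simp add: W_def V_def prod.distrib prod_powr_distrib less_imp_le)
  qed
  then have "U * ennreal (\<Prod>j\<in>UNIV. v j powr (q * (\<alpha> j / CARD('n) - 1 / p)))
      = ennpowr (ennreal W) q * U * ennreal (V powr (- q / p))"
    using \<open>0 < W\<close> by (simp add: ennpowr_ennreal ennreal_mult mult_ac)
  also have "\<dots> \<le> ennpowr (ennreal c) q * ennreal (V powr (q / p)) * ennreal (V powr (- q / p))"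
    by (intro mult_right_mono *) auto
  also have "\<dots> = ennpowr (ennreal c) q"
    using \<open>0 < V\<close> by (simp add: mult.assoc ennreal_mult[symmetric] powr_add[symmetric])
  finally show "(\<integral>\<^sup>+x\<in>block_prod Q. ennreal (u x powr q) \<partial>lebesgue) *
      ennreal (\<Prod>j\<in>UNIV. measure lebesgue (Q j) powr (q * (\<alpha> j / CARD('n) - 1 / p)))
      \<le> ennpowr (ennreal c) q"
    by (simp only: U_def R_def v_def)
qed

theorem corollary3p6:
  fixes ps :: "'m::finite \<Rightarrow> real" and p q :: real
    and \<alpha> :: "'k::finite \<Rightarrow> real"
    and u :: "real^'n^'k \<Rightarrow> real"
  assumes "2 \<le> CARD('k)"
    and "\<forall>i. 1 < ps i"
    and "1 / p = (\<Sum>i\<in>UNIV. 1 / ps i)"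
    and "p < q"
    and "\<forall>j. 0 < \<alpha> j \<and> \<alpha> j < CARD('m) * CARD('n)"
    and "AE x in lebesgue. 0 < u x"
    and "is_weight (\<lambda>x. u x powr q)"
  shows "(\<exists>c::real. 0 < c \<and>
            (\<forall>f :: 'm \<Rightarrow> real^'n^'k \<Rightarrow> real. (\<forall>i. f i \<in> lp_space (ps i)) \<longrightarrow>
               lp_norm q (\<lambda>x. ennreal \<bar>u x\<bar> * strong_frac_max \<alpha> f x)
                 \<le> ennreal c * (\<Prod>i\<in>UNIV. lp_norm (ps i) (\<lambda>x. ennreal \<bar>f i x\<bar>))))
         \<longleftrightarrow>
         (SUP Q \<in> {Q :: 'k \<Rightarrow> (real^'n) set. \<forall>j. Q j \<in> cubes}.
            (\<integral>\<^sup>+x\<in>block_prod Q. ennreal (u x powr q) \<partial>lebesgue) *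
            ennreal (\<Prod>j\<in>UNIV. measure lebesgue (Q j) powr (q * (\<alpha> j / CARD('n) - 1 / p)))) < \<infinity>"
    (is "?bounded \<longleftrightarrow> ?test < \<infinity>")
proof -
  have test: "?test = testing_constant p q \<alpha> u"
    by (simp only: testing_constant_def)
  \<comment> \<open>The index type is nonempty, so the sum that defines \<open>p\<close> is
    positive; hence \<open>p\<close>, and with it \<open>q\<close>, is positive.\<close>
  have "0 < 1 / p"
    unfolding assms(3) using assms(2) by (intro sum_pos) (auto intro: less_trans[OF zero_less_one])
  then have "0 < q"
    using \<open>p < q\<close> by simp
  show ?thesis
    unfolding test
  proof
    assume ?bounded
    then obtain c where c: "\<And>f :: 'm \<Rightarrow> real^'n^'k \<Rightarrow> real. (\<And>i. f i \<in> lp_space (ps i)) \<Longrightarrow>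
        lp_norm q (\<lambda>x. ennreal \<bar>u x\<bar> * strong_frac_max \<alpha> f x)
          \<le> ennreal c * (\<Prod>i\<in>UNIV. lp_norm (ps i) (\<lambda>x. ennreal \<bar>f i x\<bar>))"
      by blast
    have "testing_constant p q \<alpha> u \<le> ennpowr (ennreal c) q"
      using assms(2) \<open>0 < q\<close> by (intro testing_if_strong_frac_max_bounded[OF _ assms(3) _ assms(6,7) c])
        (auto intro: less_trans[OF zero_less_one])
    also have "\<dots> < \<infinity>"
      by (simp add: ennpowr_def)
    finally show "testing_constant p q \<alpha> u < \<infinity>" .
  next
    assume "testing_constant p q \<alpha> u < \<infinity>"
    then have "\<exists>c::real. 0 < c \<and> (\<forall>f :: 'm \<Rightarrow> real^'n^'k \<Rightarrow> real. (\<forall>i. f i \<in> borel_measurable lebesgue) \<longrightarrow>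
        lp_norm q (\<lambda>x. ennreal \<bar>u x\<bar> * strong_frac_max \<alpha> f x)
          \<le> ennreal c * (\<Prod>i\<in>UNIV. lp_norm (ps i) (\<lambda>x. ennreal \<bar>f i x\<bar>)))"
      using assms by (intro strong_frac_max_bounded_if_testing) auto
    then show ?bounded
      unfolding lp_space_def by blast
  qed
qed

end
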